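(* Let $f=f_1+\mathrm{i}f_2$ be a piecewise continuous function without zeros, where $f_1$ is real, $2\pi$-periodic and even and $f_2$ is real, $2\pi$-periodic and odd, having points of discontinuity $\xi_1,\xi_2,\dots,\xi_\nu\in(0,2\pi]$ with bounded jumps $\alpha_k=\lim_{x\to\xi_k^+}f(x)-\lim_{x\to\xi_k^-}f(x)$. Then the eigenvalues of $\mathcal{C}_n^{-1}(f)T_n(f)$ are clustered around $(1,0)$ in the sense of general clustering; that is, for every $\varepsilon>0$, $\mathcal{O}(\log n)$ eigenvalues lie outside the rectangle $[1-\varepsilon,1+\varepsilon]\times[-\varepsilon,\varepsilon]$ of the complex plane.
   Context: $T_n(f)$ is the $n\times n$ Toeplitz matrix with $(j,k)$ entry $\frac{1}{2\pi}\int_{-\pi}^{\pi}f(x)\mathrm{e}^{-\mathrm{i}(j-k)x}\,\mathrm{d}x$. $\mathcal{C}_n(f)=\mathcal{F}_n^H\Lambda_n(f)\mathcal{F}_n$ is the circulant matrix with eigenvalues $f\left(\frac{2\pi(k-1)}{n}\right)$, $k=1,\dots,n$, where $\Lambda_n(f)$ is the diagonal matrix of these values (in this order) and $\mathcal{F}_n=\frac{1}{\sqrt n}\left(\omega^{(j-1)(k-1)}\right)_{j,k=1}^n$, $\omega=\mathrm{e}^{2\pi\mathrm{i}/n}$; $\mathcal{C}_n^{-1}(f)=(\mathcal{C}_n(f))^{-1}$. A rectangle $[a,b]\times[c,e]$ denotes $\{z\in\mathbb{C}:\operatorname{Re}z\in[a,b],\ \operatorname{Im}z\in[c,e]\}$;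 $(1,0)$ is the complex number $1$. General clustering around a point means that for each $\varepsilon>0$ the number of eigenvalues of the $n\times n$ matrix at distance more than $\varepsilon$ from it is $o(n)$.
   Formalization: "Without zeros" is taken to mean that the one-sided limits of f, and not only its values, are nonzero; with nonzero values alone the O(log n) bound fails, e.g. for f(x)=exp(-1/|x|^3) on 0<|x|≤π, f(0)=1. *)

theory Defs
  imports
    "HOL-Analysis.Analysis"
    "HOL-Library.Landau_Symbols"
    "Jordan_Normal_Form.Gauss_Jordan_Elimination"
    "Jordan_Normal_Form.Schur_Decomposition"
begin

definition toeplitz :: "nat \<Rightarrow> (real \<Rightarrow> complex) \<Rightarrow> complex mat" where
  "toeplitz n f = Matrix.mat n n (\<lambda>(j, k).
     1 / (2 * complex_of_real pi) *
     integral {-pi..pi} (\<lambda>x. f x * exp (- (\<i> * of_int (int j - int k) * complex_of_real x))))"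

text \<open>Matrix indices start at 0, so the exponents \<open>(j - 1) (k - 1)\<close> and the sample points
  \<open>2 \<pi> (k - 1) / n\<close> of the 1-based convention appear below without the shifts.\<close>

definition fourier_mat :: "nat \<Rightarrow> complex mat" where
  "fourier_mat n = Matrix.mat n n (\<lambda>(j, k).
     1 / complex_of_real (sqrt (real n)) * exp (2 * complex_of_real pi * \<i> / of_nat n) ^ (j * k))"

definition circulant :: "nat \<Rightarrow> (real \<Rightarrow> complex) \<Rightarrow> complex mat" where
  "circulant n f =
     mat_adjoint (fourier_mat n) * mat_diag n (\<lambda>k. f (2 * pi * real k / real n)) * fourier_mat n"

text \<open>\<open>mat_inverse\<close> returns \<open>None\<close> for a singular matrix. The circulant matrices below are
  invertible for every \<open>n\<close>, because the symbol does not vanish at any point.\<close>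

definition preconditioned :: "nat \<Rightarrow> (real \<Rightarrow> complex) \<Rightarrow> complex mat" where
  "preconditioned n f = the (mat_inverse (circulant n f)) * toeplitz n f"

text \<open>Eigenvalues are counted with algebraic multiplicity.\<close>

definition num_eigenvalues_in :: "complex mat \<Rightarrow> complex set \<Rightarrow> nat" where
  "num_eigenvalues_in A S = size (filter_mset (\<lambda>z. z \<in> S) (proots (char_poly A)))"

definition rectangle :: "real \<Rightarrow> real \<Rightarrow> real \<Rightarrow> real \<Rightarrow> complex set" where
  "rectangle a b c e = {z. Re z \<in> {a..b} \<and> Im z \<in> {c..e}}"

text \<open>\<open>A n\<close> is meant to be an \<open>n \<times> n\<close> matrix.\<close>

definition general_clustering :: "(nat \<Rightarrow> complex mat) \<Rightarrow> complex \<Rightarrow> bool" where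
  "general_clustering A p \<longleftrightarrow>
     (\<forall>\<epsilon>>0. (\<lambda>n. real (num_eigenvalues_in (A n) {z. dist z p > \<epsilon>})) \<in> o(\<lambda>n. real n))"

text \<open>The jump is bounded: both one-sided limits exist and are finite.\<close>

definition has_jump :: "(real \<Rightarrow> complex) \<Rightarrow> real \<Rightarrow> complex \<Rightarrow> bool" where
  "has_jump f x \<alpha> \<longleftrightarrow>
     (\<exists>r l. (f \<longlongrightarrow> r) (at_right x) \<and> (f \<longlongrightarrow> l) (at_left x) \<and> \<alpha> = r - l)"

text \<open>A piecewise continuous function is without zeros if its values and its one-sided limits
  are nonzero; the limits are the values of its continuous pieces at the end points of the
  pieces. For a periodic function this means that it is bounded away from zero.
  If one-sided limits could vanish, the circulant matrices would still be invertible, but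
  the \<open>O(log n)\<close> bound would fail, for example for the even periodic function equal to
  \<open>exp (- 1 / \<bar>x\<bar>^3)\<close> for \<open>0 < \<bar>x\<bar> \<le> \<pi>\<close> and to \<open>1\<close> at \<open>0\<close>.\<close>

definition without_zeros :: "(real \<Rightarrow> complex) \<Rightarrow> bool" where
  "without_zeros f \<longleftrightarrow>
     (\<forall>x. f x \<noteq> 0) \<and>
     (\<forall>x l. (f \<longlongrightarrow> l) (at_right x) \<or> (f \<longlongrightarrow> l) (at_left x) \<longrightarrow> l \<noteq> 0)"

end

theory Submission
  imports Defs "HOL-Real_Asymp.Real_Asymp"
begin

text \<open>
  Write \<open>T\<close> and \<open>C\<close> for the Toeplitz and the circulant matrix of the symbol \<open>f\<close>. The
  eigenvalues of \<open>C\<^sup>-\<^sup>1 T\<close> are among the numbers \<open>x\<^sup>* C\<^sup>-\<^sup>1 T x\<close> with \<open>x\<close> a unit vector, and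
  \<open>x\<^sup>* C\<^sup>-\<^sup>1 T x - 1 = x\<^sup>* C\<^sup>-\<^sup>1 (T - C) x\<close>. So everything rests on splitting \<open>T - C\<close> into a part of
  small operator norm and a part whose squared Frobenius norm is \<open>O(log n)\<close>.

  Because \<open>f\<close> has one-sided limits everywhere, compactness gives a step function \<open>u\<close> that
  is uniformly close to \<open>f\<close> (\<open>well_sampled_step_approx\<close>). Both matrices depend linearly on the
  symbol, and the sesquilinear form of either is bounded by the supremum of its symbol, by Parseval's
  identity on the circle and on the grid (\<open>toeplitz_form_bound\<close>, \<open>circulant_form_bound\<close>). Hence
  replacing \<open>f\<close> by \<open>u\<close> changes \<open>T - C\<close> only by a matrix of small operator norm.

  For the indicator of an arc the Fourier coefficient and its sampled version are both
  explicit, one with the factor \<open>1 / (\<i> \<theta>)\<close> and the other with \<open>1 / (1 - exp (- \<i> \<theta>))\<close>, where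
  \<open>\<theta> = 2 \<pi> d / n\<close>. These two factors have the same pole at \<open>\<theta> = 0\<close>, and their difference only blows
  up at \<open>\<theta> = \<plusminus> 2 \<pi>\<close>. This bounds the entry of \<open>T - C\<close> on diagonal \<open>d\<close> by \<open>K / (n - \<bar>d\<bar>)\<close>
  (\<open>well_sampled_step\<close>). That diagonal has \<open>n - \<bar>d\<bar>\<close> entries, so the squared Frobenius norm is a
  harmonic sum (\<open>sum_inverse_square_distance_le\<close>).

  Finally, a unitary change of basis puts the eigenvalues on the diagonal
  (\<open>unitary_diagonal_eigenvalues\<close>), so that they are values of the form at orthonormal
  vectors \<open>x\<close>. An eigenvalue at distance more than \<open>\<epsilon>\<close> from 1 forces the Frobenius part to
  satisfy \<open>\<bar>R x\<bar>\<^sup>2 \<ge> s\<^sup>2\<close> for a constant \<open>s > 0\<close>. Summed over orthonormal vectors these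
  quantities do not exceed the squared Frobenius norm, so there are at most \<open>O(log n)\<close> such
  eigenvalues (\<open>num_eigenvalues_le\<close>). The
  factor \<open>C\<^sup>-\<^sup>1\<close> is harmless because \<open>f\<close> is bounded away from zero, so that its norm is bounded
  independently of \<open>n\<close> (\<open>circulant_inverse_adjoint_bound\<close>).
\<close>

section \<open>Exponentials on the circle\<close>

definition wave :: "int \<Rightarrow> real \<Rightarrow> complex" where
  "wave d x = exp (\<i> * complex_of_real (of_int d * x))"

lemma norm_wave [simp]: "norm (wave d x) = 1"
  by (simp add: wave_def flip: of_real_mult)

lemma wave_0 [simp]: "wave 0 x = 1" "wave d 0 = 1"
  by (simp_all add: wave_def)

lemma wave_add: "wave (d + e) x = wave d x * wave e x"
  by (simp add: wave_def ring_distribs exp_add)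

lemma cnj_wave: "cnj (wave d x) = wave (- d) x"
  by (simp add: wave_def exp_cnj)

lemma wave_2pi: "wave d (2 * pi) = 1"
  using exp_integer_2pi[of "of_int d"] by (simp add: wave_def mult_ac)

lemma wave_period: "wave d (x + 2 * pi) = wave d x"
proof -
  have "wave d (x + 2 * pi) = wave d x * wave d (2 * pi)"
    by (simp add: wave_def ring_distribs exp_add)
  then show ?thesis by (simp add: wave_2pi)
qed

lemma continuous_on_wave [continuous_intros]: "continuous_on S (wave d)"
  unfolding wave_def by (intro continuous_intros)

lemma sin_ge_chord:
  assumes "0 \<le> u" "u \<le> pi / 2"
  shows "2 / pi * u \<le> sin u"
proof -
  have "convex_on {0..pi/2} (\<lambda>x. - sin x)"
  proof (rule f''_ge0_imp_convex[where f' = "\<lambda>x. - cos x" and f'' = sin])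
    fix x :: real assume "x \<in> {0..pi/2}"
    then show "0 \<le> sin x" by (intro sin_ge_zero) auto
  qed (auto intro!: derivative_eq_intros)
  from convex_onD[OF this, of "2 / pi * u" 0 "pi / 2"] show ?thesis
    using assms by (simp add: field_simps)
qed

text \<open>Vanishing at both ends of the half period is what matters here: the zero at \<open>\<pi>\<close> becomes the
  factor \<open>2 \<pi> - \<bar>\<theta>\<bar>\<close> below.\<close>

lemma sin_ge_parabola:
  assumes "0 \<le> u" "u \<le> pi"
  shows "2 / pi\<^sup>2 * u * (pi - u) \<le> sin u"
proof (cases "u \<le> pi / 2")
  case True
  have "2 / pi\<^sup>2 * u * (pi - u) \<le> 2 / pi\<^sup>2 * u * pi"
    using assms by (intro mult_left_mono) auto
  also have "\<dots> = 2 / pi * u" by (simp add: power2_eq_square)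
  finally show ?thesis using sin_ge_chord[OF assms(1) True] by linarith
next
  case False
  have "2 / pi\<^sup>2 * u * (pi - u) \<le> 2 / pi\<^sup>2 * pi * (pi - u)"
    using assms by (intro mult_left_mono mult_right_mono) auto
  also have "\<dots> = 2 / pi * (pi - u)" by (simp add: power2_eq_square)
  also have "\<dots> \<le> sin (pi - u)" using False assms by (intro sin_ge_chord) auto
  finally show ?thesis by simp
qed

text \<open>The sampled and the continuous Fourier transform of an arc differ by this kernel. The
  singularities of the two terms at \<open>\<theta> = 0\<close> cancel, since the numerator \<open>exp (- \<i> \<theta>) - 1 + \<i> \<theta>\<close> vanishes
  to second order; only the poles of the periodic term at \<open>\<plusminus> 2 \<pi>\<close> remain.\<close>

lemma exp_i_secant_error:
  fixes \<theta> :: real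
  assumes "\<theta> \<noteq> 0" "\<bar>\<theta>\<bar> < 2 * pi"
  shows "norm (1 / (1 - exp (- (\<i> * \<theta>))) - 1 / (\<i> * \<theta>)) \<le> pi\<^sup>2 / (2 * pi - \<bar>\<theta>\<bar>)"
    and "exp (- (\<i> * \<theta>)) \<noteq> 1"
proof -
  define w where "w = exp (- (\<i> * complex_of_real \<theta>))"
  have "norm (1 - w) = 2 * \<bar>sin (\<theta> / 2)\<bar>"
    using dist_exp_i_1[of "- \<theta>"] by (simp add: w_def norm_minus_commute)
  also have "\<bar>sin (\<theta> / 2)\<bar> = sin (\<bar>\<theta>\<bar> / 2)"
    using assms sin_ge_zero[of "\<bar>\<theta>\<bar> / 2"] by (auto simp: abs_if split: if_splits)
  finally have nw: "norm (1 - w) = 2 * sin (\<bar>\<theta>\<bar> / 2)" .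
  have lower: "\<bar>\<theta>\<bar> * (2 * pi - \<bar>\<theta>\<bar>) / pi\<^sup>2 \<le> norm (1 - w)"
    using sin_ge_parabola[of "\<bar>\<theta>\<bar> / 2"] assms unfolding nw by (simp add: field_simps)
  moreover have pos: "0 < \<bar>\<theta>\<bar> * (2 * pi - \<bar>\<theta>\<bar>) / pi\<^sup>2" using assms by auto
  ultimately have w1: "w \<noteq> 1" by auto
  then show "exp (- (\<i> * \<theta>)) \<noteq> 1" by (simp add: w_def)
  have "1 / (1 - w) - 1 / (\<i> * \<theta>) = (w - 1 + \<i> * \<theta>) / ((1 - w) * (\<i> * \<theta>))"
    using w1 assms by (simp add: field_simps)
  also have "norm \<dots> = norm (w - 1 + \<i> * \<theta>) / (norm (1 - w) * \<bar>\<theta>\<bar>)"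
    by (simp add: norm_divide norm_mult)
  also have "\<dots> \<le> \<theta>\<^sup>2 / (\<bar>\<theta>\<bar> * (2 * pi - \<bar>\<theta>\<bar>) / pi\<^sup>2 * \<bar>\<theta>\<bar>)"
  proof (intro frac_le mult_right_mono lower)
    show "norm (w - 1 + \<i> * \<theta>) \<le> \<theta>\<^sup>2"
      using Taylor_exp[of "- (\<i> * complex_of_real \<theta>)" 1]
      by (simp add: w_def algebra_simps norm_mult power2_eq_square)
  qed (use pos assms in auto)
  also have "\<dots> = pi\<^sup>2 / (2 * pi - \<bar>\<theta>\<bar>)"
    using assms by (simp add: power2_eq_square field_simps abs_if)
  finally show "norm (1 / (1 - exp (- (\<i> * \<theta>))) - 1 / (\<i> * \<theta>)) \<le> pi\<^sup>2 / (2 * pi - \<bar>\<theta>\<bar>)"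
    by (simp add: w_def)
qed

lemma wave_Lipschitz: "norm (wave d x - wave d y) \<le> \<bar>of_int d\<bar> * \<bar>x - y\<bar>"
proof -
  have "wave d x - wave d y = wave d y * (exp (\<i> * complex_of_real (of_int d * (x - y))) - 1)"
    by (simp add: wave_def ring_distribs right_diff_distrib exp_diff)
  then have "norm (wave d x - wave d y) = 2 * \<bar>sin (of_int d * (x - y) / 2)\<bar>"
    by (simp only: norm_mult norm_wave dist_exp_i_1)
  also have "\<dots> \<le> 2 * \<bar>of_int d * (x - y) / 2\<bar>"
    by (intro mult_left_mono abs_sin_x_le_abs_x) auto
  finally show ?thesis by (simp add: abs_mult)
qed

section \<open>Fourier coefficients and their sampled versions\<close>

definition fourier_coeff :: "(real \<Rightarrow> complex) \<Rightarrow> int \<Rightarrow> complex" where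
  "fourier_coeff u d = 1 / (2 * complex_of_real pi) * integral {0..2 * pi} (\<lambda>x. u x * wave (- d) x)"

definition grid_point :: "nat \<Rightarrow> nat \<Rightarrow> real" where
  "grid_point n l = 2 * pi * real l / real n"

definition sampled_coeff :: "nat \<Rightarrow> (real \<Rightarrow> complex) \<Rightarrow> int \<Rightarrow> complex" where
  "sampled_coeff n u d = 1 / of_nat n * (\<Sum>l<n. u (grid_point n l) * wave (- d) (grid_point n l))"

definition fourier_integrable :: "(real \<Rightarrow> complex) \<Rightarrow> bool" where
  "fourier_integrable u \<longleftrightarrow> (\<forall>d. (\<lambda>x. u x * wave d x) integrable_on {0..2 * pi})"

text \<open>The rate is chosen for its effect on Toeplitz matrices: an \<open>n \<times> n\<close> matrix has \<open>n - \<bar>d\<bar>\<close>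
  entries on diagonal \<open>d\<close>, so this bound makes the squared Frobenius norm of the difference of
  the two matrices a harmonic sum. It is weak enough to hold for functions with jumps.\<close>

definition well_sampled :: "(real \<Rightarrow> complex) \<Rightarrow> bool" where
  "well_sampled u \<longleftrightarrow> fourier_integrable u \<and>
     (\<exists>K. \<forall>n d. \<bar>d\<bar> < int n \<longrightarrow>
        norm (sampled_coeff n u d - fourier_coeff u d) \<le> K / real_of_int (int n - \<bar>d\<bar>))"

lemma fourier_integrable_add:
  "fourier_integrable u \<Longrightarrow> fourier_integrable v \<Longrightarrow> fourier_integrable (\<lambda>x. u x + v x)"
  by (auto simp: fourier_integrable_def ring_distribs intro!: integrable_add)

lemma fourier_integrable_cmult:
  "fourier_integrable u \<Longrightarrow> fourier_integrable (\<lambda>x. c * u x)"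
  by (auto simp: fourier_integrable_def mult.assoc intro!: integrable_on_mult_right)

lemma fourier_coeff_add:
  "fourier_integrable u \<Longrightarrow> fourier_integrable v \<Longrightarrow>
   fourier_coeff (\<lambda>x. u x + v x) d = fourier_coeff u d + fourier_coeff v d"
  by (simp add: fourier_integrable_def fourier_coeff_def ring_distribs integral_add)

lemma fourier_coeff_cmult: "fourier_coeff (\<lambda>x. c * u x) d = c * fourier_coeff u d"
  by (simp add: fourier_coeff_def mult.assoc)

lemma sampled_coeff_add:
  "sampled_coeff n (\<lambda>x. u x + v x) d = sampled_coeff n u d + sampled_coeff n v d"
  by (simp add: sampled_coeff_def ring_distribs sum.distrib)

lemma sampled_coeff_cmult: "sampled_coeff n (\<lambda>x. c * u x) d = c * sampled_coeff n u d"
  by (simp add: sampled_coeff_def sum_distrib_left mult_ac)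

lemma well_sampled_add:
  assumes "well_sampled u" "well_sampled v"
  shows "well_sampled (\<lambda>x. u x + v x)"
proof -
  from assms obtain K L where
    u: "fourier_integrable u" "\<And>n d. \<bar>d\<bar> < int n \<Longrightarrow>
        norm (sampled_coeff n u d - fourier_coeff u d) \<le> K / real_of_int (int n - \<bar>d\<bar>)" and
    v: "fourier_integrable v" "\<And>n d. \<bar>d\<bar> < int n \<Longrightarrow>
        norm (sampled_coeff n v d - fourier_coeff v d) \<le> L / real_of_int (int n - \<bar>d\<bar>)"
    unfolding well_sampled_def by metis
  have "norm (sampled_coeff n (\<lambda>x. u x + v x) d - fourier_coeff (\<lambda>x. u x + v x) d)
      \<le> (K + L) / real_of_int (int n - \<bar>d\<bar>)" if "\<bar>d\<bar> < int n" for n d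
  proof -
    have "sampled_coeff n (\<lambda>x. u x + v x) d - fourier_coeff (\<lambda>x. u x + v x) d =
       (sampled_coeff n u d - fourier_coeff u d) + (sampled_coeff n v d - fourier_coeff v d)"
      by (simp add: sampled_coeff_add fourier_coeff_add u v)
    then show ?thesis
      using norm_triangle_mono[OF u(2)[OF that] v(2)[OF that]] by (simp add: add_divide_distrib)
  qed
  then show ?thesis
    using fourier_integrable_add[OF u(1) v(1)] unfolding well_sampled_def by blast
qed

lemma well_sampled_cmult:
  assumes "well_sampled u"
  shows "well_sampled (\<lambda>x. c * u x)"
proof -
  from assms obtain K where
    u: "fourier_integrable u" "\<And>n d. \<bar>d\<bar> < int n \<Longrightarrow>
        norm (sampled_coeff n u d - fourier_coeff u d) \<le> K / real_of_int (int n - \<bar>d\<bar>)"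
    unfolding well_sampled_def by metis
  have "norm (sampled_coeff n (\<lambda>x. c * u x) d - fourier_coeff (\<lambda>x. c * u x) d)
      \<le> (norm c * K) / real_of_int (int n - \<bar>d\<bar>)" if "\<bar>d\<bar> < int n" for n d
  proof -
    have "sampled_coeff n (\<lambda>x. c * u x) d - fourier_coeff (\<lambda>x. c * u x) d =
       c * (sampled_coeff n u d - fourier_coeff u d)"
      by (simp add: sampled_coeff_cmult fourier_coeff_cmult right_diff_distrib)
    then show ?thesis
      using mult_left_mono[OF u(2)[OF that] norm_ge_zero[of c]] by (simp add: norm_mult)
  qed
  then show ?thesis
    using fourier_integrable_cmult[OF u(1)] unfolding well_sampled_def by blast
qed

lemma has_integral_wave:
  assumes "0 \<le> \<xi>"
  shows "(wave (- d) has_integral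
     (if d = 0 then complex_of_real \<xi> else (1 - wave (- d) \<xi>) / (\<i> * of_int d))) {0..\<xi>}"
proof (cases "d = 0")
  case True
  then have "wave (- d) = (\<lambda>_. 1)" by auto
  then show ?thesis
    using True has_integral_const_real[of "1::complex" 0 \<xi>] assms by (simp add: scaleR_conv_of_real)
next
  case False
  have "(wave (- d) has_integral
     (wave (- d) \<xi> / (- (\<i> * of_int d)) - wave (- d) 0 / (- (\<i> * of_int d)))) {0..\<xi>}"
  proof (rule fundamental_theorem_of_calculus[OF assms(1)])
    fix x
    have "((\<lambda>x. exp (\<i> * (of_int (- d) * x)) / (- (\<i> * of_int d))) has_field_derivative
       exp (\<i> * (of_int (- d) * complex_of_real x))) (at (complex_of_real x))"
      using False by (auto intro!: derivative_eq_intros simp: field_simps)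
    then show "((\<lambda>x. wave (- d) x / (- (\<i> * of_int d))) has_vector_derivative wave (- d) x)
       (at x within {0..\<xi>})"
      unfolding wave_def using has_vector_derivative_real_field by (fastforce simp: of_real_mult)
  qed
  then show ?thesis using False by (simp add: diff_divide_distrib)
qed

lemma has_integral_step:
  assumes "0 \<le> \<xi>" "\<xi> \<le> 2 * pi"
  shows "((\<lambda>x. (if x < \<xi> then 1 else 0) * wave (- d) x) has_integral
     (if d = 0 then complex_of_real \<xi> else (1 - wave (- d) \<xi>) / (\<i> * of_int d))) {0..2 * pi}"
proof -
  have "((\<lambda>x. if x \<in> {0..\<xi>} then wave (- d) x else 0) has_integral
     (if d = 0 then complex_of_real \<xi> else (1 - wave (- d) \<xi>) / (\<i> * of_int d))) {0..2 * pi}"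
    using has_integral_wave[OF assms(1)] assms(2) by (subst has_integral_restrict) auto
  then show ?thesis
    by (rule has_integral_spike[rotated 2, where S = "{\<xi>}"]) auto
qed

lemma fourier_integrable_step:
  assumes "0 \<le> \<xi>" "\<xi> \<le> 2 * pi"
  shows "fourier_integrable (\<lambda>x. if x < \<xi> then 1 else 0)"
  unfolding fourier_integrable_def
proof
  fix d
  show "(\<lambda>x. (if x < \<xi> then 1 else 0) * wave d x) integrable_on {0..2 * pi}"
    using has_integral_integrable[OF has_integral_step[OF assms, of "- d"]] by simp
qed

lemma fourier_coeff_step:
  assumes "0 \<le> \<xi>" "\<xi> \<le> 2 * pi"
  shows "fourier_coeff (\<lambda>x. if x < \<xi> then 1 else 0) d =
    (if d = 0 then complex_of_real (\<xi> / (2 * pi))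
     else (1 - wave (- d) \<xi>) / (2 * pi * \<i> * of_int d))"
  unfolding fourier_coeff_def integral_unique[OF has_integral_step[OF assms]] by simp

lemma wave_grid_point: "wave (- d) (grid_point n l) = exp (- (\<i> * complex_of_real (of_int d * 2 * pi / real n))) ^ l"
  by (simp add: wave_def grid_point_def field_simps flip: exp_of_nat_mult)

text \<open>The jump is first moved to the next grid point \<open>2 \<pi> m / n\<close>. This leaves the sampled coefficient
  unchanged and moves the Fourier coefficient by at most \<open>1 / n\<close>. At a grid point both
  coefficients contain the same factor \<open>1 - w ^ m\<close>, and what remains is the kernel of
  \<open>exp_i_secant_error\<close>.\<close>

lemma well_sampled_step:
  assumes "0 \<le> \<xi>" "\<xi> \<le> 2 * pi"
  shows "well_sampled (\<lambda>x. if x < \<xi> then 1 else 0)" (is "well_sampled ?u")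
proof -
  have "norm (sampled_coeff n ?u d - fourier_coeff ?u d) \<le> (pi + 1) / real_of_int (int n - \<bar>d\<bar>)"
    if d: "\<bar>d\<bar> < int n" for n d
  proof -
    have n: "n > 0" using d by auto
    \<comment> \<open>The number of grid points that lie to the left of the jump.\<close>
    define m where "m = nat \<lceil>n * \<xi> / (2 * pi)\<rceil>"
    have lt_m: "grid_point n l < \<xi> \<longleftrightarrow> l < m" for l
      using n by (simp add: m_def grid_point_def zless_nat_conj less_ceiling_iff field_simps zless_nat_eq_int_zless)
    have m_le: "m \<le> n"
    proof -
      have "\<not> grid_point n n < \<xi>" using assms n by (simp add: grid_point_def)
      then show ?thesis unfolding lt_m by simp
    qed
    have near: "\<bar>grid_point n m - \<xi>\<bar> \<le> 2 * pi / n"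
    proof -
      have "real m = real_of_int \<lceil>n * \<xi> / (2 * pi)\<rceil>" using assms by (simp add: m_def)
      then have "n * \<xi> / (2 * pi) \<le> m" "m < n * \<xi> / (2 * pi) + 1" by linarith+
      moreover have "grid_point n m - \<xi> = 2 * pi / n * (m - n * \<xi> / (2 * pi))"
        using n by (simp add: grid_point_def field_simps)
      moreover have "2 * pi / n * (m - n * \<xi> / (2 * pi)) \<le> 2 * pi / n * 1"
        using calculation by (intro mult_left_mono) auto
      moreover have "0 \<le> 2 * pi / n * (m - n * \<xi> / (2 * pi))"
        using calculation by (intro mult_nonneg_nonneg) auto
      ultimately show ?thesis by simp
    qed
    define v where "v = (\<lambda>x. if x < grid_point n m then 1 else (0::complex))"
    have node_m: "0 \<le> grid_point n m" "grid_point n m \<le> 2 * pi"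
      using n m_le by (auto simp: grid_point_def field_simps)
    have fourier_v: "norm (fourier_coeff v d - fourier_coeff ?u d) \<le> 1 / n"
    proof (cases "d = 0")
      case True
      have "fourier_coeff v d - fourier_coeff ?u d = complex_of_real ((grid_point n m - \<xi>) / (2 * pi))"
        using fourier_coeff_step[OF assms, of d] fourier_coeff_step[OF node_m, of d] True
        by (simp add: v_def diff_divide_distrib)
      then have "norm (fourier_coeff v d - fourier_coeff ?u d) = \<bar>(grid_point n m - \<xi>) / (2 * pi)\<bar>"
        by (simp only: norm_of_real)
      also have "\<dots> \<le> 1 / n" using near by (simp add: field_simps)
      finally show ?thesis .
    next
      case False
      have "fourier_coeff v d - fourier_coeff ?u d = (wave (- d) \<xi> - wave (- d) (grid_point n m)) / (2 * pi * \<i> * of_int d)"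
        using fourier_coeff_step[OF assms, of d] fourier_coeff_step[OF node_m, of d] False
        by (simp add: v_def diff_divide_distrib)
      also have "norm \<dots> = norm (wave (- d) \<xi> - wave (- d) (grid_point n m)) / (2 * pi * \<bar>of_int d\<bar>)"
        by (simp add: norm_divide norm_mult)
      also have "\<dots> \<le> (\<bar>of_int d\<bar> * (2 * pi / n)) / (2 * pi * \<bar>of_int d\<bar>)"
      proof (intro divide_right_mono)
        have "norm (wave (- d) \<xi> - wave (- d) (grid_point n m)) \<le> \<bar>of_int d\<bar> * \<bar>\<xi> - grid_point n m\<bar>"
          using wave_Lipschitz[of "- d"] by simp
        also have "\<dots> \<le> \<bar>of_int d\<bar> * (2 * pi / n)"
          using near by (intro mult_left_mono) (auto simp: abs_minus_commute)
        finally show "norm (wave (- d) \<xi> - wave (- d) (grid_point n m)) \<le> \<bar>of_int d\<bar> * (2 * pi / n)" .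
      qed auto
      also have "\<dots> = 1 / n" using False by simp
      finally show ?thesis .
    qed
    have sampled: "sampled_coeff n ?u d = 1 / n * (\<Sum>l<m. wave (- d) (grid_point n l))"
    proof -
      have "(\<Sum>l<n. ?u (grid_point n l) * wave (- d) (grid_point n l)) = (\<Sum>l<m. wave (- d) (grid_point n l))"
        using m_le by (intro sum.mono_neutral_cong_right) (auto simp: lt_m)
      then show ?thesis by (simp add: sampled_coeff_def)
    qed
    have sampled_v: "norm (sampled_coeff n ?u d - fourier_coeff v d) \<le> pi / real_of_int (int n - \<bar>d\<bar>)"
    proof (cases "d = 0")
      case True
      have "fourier_coeff v d = of_nat m / of_nat n"
        using fourier_coeff_step[OF node_m, of d] True by (simp add: v_def grid_point_def)
      moreover have "sampled_coeff n ?u d = of_nat m / of_nat n" 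
        unfolding sampled using True by simp
      ultimately show ?thesis by (simp add: True)
    next
      case False
      define \<theta> where "\<theta> = of_int d * 2 * pi / real n"
      define w where "w = exp (- (\<i> * complex_of_real \<theta>))"
      have \<theta>: "\<theta> \<noteq> 0" "\<bar>\<theta>\<bar> < 2 * pi"
      proof -
        have "\<bar>real_of_int d\<bar> < real n" using d by linarith
        then show "\<bar>\<theta>\<bar> < 2 * pi" using n by (simp add: \<theta>_def abs_mult field_simps)
      qed (use False n in \<open>auto simp: \<theta>_def\<close>)
      have w: "w \<noteq> 1" using exp_i_secant_error(2)[OF \<theta>] by (simp add: w_def)
      have 1: "sampled_coeff n ?u d = 1 / n * ((1 - w ^ m) / (1 - w))"
        unfolding sampled wave_grid_point by (simp add: sum_gp_strict w \<theta>_def[symmetric] flip: w_def)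
      have 2: "fourier_coeff v d = 1 / n * ((1 - w ^ m) / (\<i> * \<theta>))"
        using fourier_coeff_step[OF node_m, of d] False n
        unfolding v_def wave_grid_point by (simp add: \<theta>_def[symmetric] flip: w_def) (simp add: \<theta>_def)
      have "sampled_coeff n ?u d - fourier_coeff v d = 1 / n * (1 - w ^ m) * (1 / (1 - w) - 1 / (\<i> * \<theta>))"
        unfolding 1 2 by (simp only: right_diff_distrib times_divide_eq_right mult_1_right)
      also have "norm \<dots> = 1 / n * norm (1 - w ^ m) * norm (1 / (1 - w) - 1 / (\<i> * \<theta>))"
        by (simp add: norm_mult norm_divide)
      also have "\<dots> \<le> 1 / n * 2 * (pi\<^sup>2 / (2 * pi - \<bar>\<theta>\<bar>))"
      proof (intro mult_mono)
        have "norm (1 - w ^ m) \<le> norm (1::complex) + norm (w ^ m)" by (rule norm_triangle_ineq4)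
        also have "norm (w ^ m) = 1" by (simp add: norm_power w_def)
        finally show "norm (1 - w ^ m) \<le> 2" by simp
        show "norm (1 / (1 - w) - 1 / (\<i> * \<theta>)) \<le> pi\<^sup>2 / (2 * pi - \<bar>\<theta>\<bar>)"
          using exp_i_secant_error(1)[OF \<theta>] by (simp add: w_def)
      qed auto
      also have "2 * pi - \<bar>\<theta>\<bar> = 2 * pi / n * real_of_int (int n - \<bar>d\<bar>)"
        using n by (simp add: \<theta>_def abs_mult field_simps)
      also have "1 / n * 2 * (pi\<^sup>2 / (2 * pi / n * real_of_int (int n - \<bar>d\<bar>))) = pi / real_of_int (int n - \<bar>d\<bar>)"
      proof -
        have "real n - \<bar>real_of_int d\<bar> > 0" using d by linarith
        then show ?thesis using n by (simp add: power2_eq_square divide_simps)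
      qed
      finally show ?thesis .
    qed
    have "1 / real n \<le> 1 / real_of_int (int n - \<bar>d\<bar>)"
      using d by (intro divide_left_mono) auto
    then have "norm (sampled_coeff n ?u d - fourier_coeff ?u d) \<le>
       pi / real_of_int (int n - \<bar>d\<bar>) + 1 / real_of_int (int n - \<bar>d\<bar>)"
      using norm_triangle_mono[OF sampled_v fourier_v] by simp
    then show ?thesis by (simp add: add_divide_distrib)
  qed
  then show ?thesis
    using fourier_integrable_step[OF assms] unfolding well_sampled_def by blast
qed

lemma well_sampled_point: "well_sampled (\<lambda>x. if x = p then 1 else 0)" (is "well_sampled ?u")
proof -
  have int: "((\<lambda>x. ?u x * wave d x) has_integral 0) {0..2 * pi}" for d
    by (rule has_integral_spike_finite[of "{p}" _ _ "\<lambda>_. 0"]) auto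
  have "norm (sampled_coeff n ?u d - fourier_coeff ?u d) \<le> 1 / real_of_int (int n - \<bar>d\<bar>)"
    if d: "\<bar>d\<bar> < int n" for n d
  proof -
    have n: "n > 0" using d by auto
    have "fourier_coeff ?u d = 0" 
      unfolding fourier_coeff_def integral_unique[OF int] by simp
    moreover have "norm (\<Sum>l<n. ?u (grid_point n l) * wave (- d) (grid_point n l)) \<le> 1"
    proof (cases "\<exists>l<n. grid_point n l = p")
      case True
      then obtain k where k: "k < n" "grid_point n k = p" by blast
      have "grid_point n l = p \<longleftrightarrow> l = k" for l
        using n unfolding k(2)[symmetric] by (auto simp: grid_point_def)
      then have "(\<Sum>l<n. ?u (grid_point n l) * wave (- d) (grid_point n l)) = (\<Sum>l<n. if l = k then wave (- d) (grid_point n k) else 0)"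
        by (intro sum.cong) auto
      then show ?thesis using k by simp
    next
      case False
      then have "(\<Sum>l<n. ?u (grid_point n l) * wave (- d) (grid_point n l)) = 0"
        by (intro sum.neutral) auto
      then show ?thesis by simp
    qed
    ultimately have "norm (sampled_coeff n ?u d - fourier_coeff ?u d) \<le> 1 / real n"
      using n by (simp add: sampled_coeff_def norm_divide divide_right_mono)
    also have "\<dots> \<le> 1 / real_of_int (int n - \<bar>d\<bar>)"
      using d by (intro divide_left_mono) auto
    finally show ?thesis .
  qed
  moreover have "fourier_integrable ?u"
    unfolding fourier_integrable_def using has_integral_integrable[OF int] by blast
  ultimately show ?thesis unfolding well_sampled_def by blast
qed

section \<open>Symbols with one-sided limits\<close>

text \<open>The point 0 lies outside the half-open period, so its right-hand limit is transported from \<open>2 \<pi>\<close>.\<close>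

lemma one_sided_limits:
  fixes f :: "real \<Rightarrow> complex"
  assumes per: "\<And>x. f (x + 2 * pi) = f x"
    and disc: "\<And>x. x \<in> {0<..2 * pi} \<Longrightarrow> \<not> isCont f x \<Longrightarrow> \<exists>\<alpha>. has_jump f x \<alpha>"
  shows "0 \<le> x \<Longrightarrow> x < 2 * pi \<Longrightarrow> \<exists>r. (f \<longlongrightarrow> r) (at_right x)"
    and "0 < x \<Longrightarrow> x \<le> 2 * pi \<Longrightarrow> \<exists>l. (f \<longlongrightarrow> l) (at_left x)"
proof -
  have both: "(\<exists>r. (f \<longlongrightarrow> r) (at_right y)) \<and> (\<exists>l. (f \<longlongrightarrow> l) (at_left y))"
    if y: "y \<in> {0<..2 * pi}" for y
  proof (cases "isCont f y")
    case True
    then have "(f \<longlongrightarrow> f y) (at_right y)" "(f \<longlongrightarrow> f y) (at_left y)"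
      unfolding isCont_def filterlim_at_split by blast+
    then show ?thesis by blast
  next
    case False
    then show ?thesis using disc[OF y] unfolding has_jump_def by blast
  qed
  then show "0 < x \<Longrightarrow> x \<le> 2 * pi \<Longrightarrow> \<exists>l. (f \<longlongrightarrow> l) (at_left x)" by auto
  show "\<exists>r. (f \<longlongrightarrow> r) (at_right x)" if x: "0 \<le> x" "x < 2 * pi"
  proof (cases "x = 0")
    case True
    obtain r where "(f \<longlongrightarrow> r) (at_right (2 * pi))" using both[of "2 * pi"] by auto
    then have "((\<lambda>x. f (x + 2 * pi)) \<longlongrightarrow> r) (at_right 0)"
      unfolding at_right_to_0[of "2 * pi"] filterlim_filtermap .
    then show ?thesis using True by (auto simp: per)
  qed (use both x in auto)
qed

text \<open>Near a point \<open>x\<close> the function is almost constant on either side, so a combination of two arcs and the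
  point \<open>x\<close> itself approximates it. Bolzano's bisection glues these local approximations. The
  approximants of adjacent intervals are added, which is why they live on half-open
  intervals and vanish elsewhere; the end point \<open>2 \<pi>\<close> is repaired afterwards.\<close>

lemma well_sampled_step_approx:
  fixes f :: "real \<Rightarrow> complex"
  assumes right: "\<And>x. 0 \<le> x \<Longrightarrow> x < 2 * pi \<Longrightarrow> \<exists>r. (f \<longlongrightarrow> r) (at_right x)"
    and left: "\<And>x. 0 < x \<Longrightarrow> x \<le> 2 * pi \<Longrightarrow> \<exists>l. (f \<longlongrightarrow> l) (at_left x)"
    and \<delta>: "\<delta> > 0"
  obtains u where "well_sampled u" "\<And>x. x \<in> {0..2 * pi} \<Longrightarrow> norm (f x - u x) \<le> \<delta>"
proof -
  define P where "P a b \<longleftrightarrow> (0 \<le> a \<and> b \<le> 2 * pi \<longrightarrow> (\<exists>u. well_sampled u \<and>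
     (\<forall>x. x \<notin> {a..<b} \<longrightarrow> u x = 0) \<and> (\<forall>x\<in>{a..<b}. norm (f x - u x) \<le> \<delta>)))" for a b :: real
  have "P 0 (2 * pi)"
  proof (rule Bolzano)
    fix a b c assume trans: "P a b" "P b c" "a \<le> b" "b \<le> c"
    show "P a c" unfolding P_def
    proof (intro impI)
      assume "0 \<le> a \<and> c \<le> 2 * pi"
      then have ab: "0 \<le> a \<and> b \<le> 2 * pi" and bc: "0 \<le> b \<and> c \<le> 2 * pi"
        using trans(3,4) by auto
      from trans(1)[unfolded P_def, rule_format, OF ab] obtain u where
        u: "well_sampled u" "\<And>x. x \<notin> {a..<b} \<Longrightarrow> u x = 0" "\<And>x. x \<in> {a..<b} \<Longrightarrow> norm (f x - u x) \<le> \<delta>"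
        by blast
      from trans(2)[unfolded P_def, rule_format, OF bc] obtain v where
        v: "well_sampled v" "\<And>x. x \<notin> {b..<c} \<Longrightarrow> v x = 0" "\<And>x. x \<in> {b..<c} \<Longrightarrow> norm (f x - v x) \<le> \<delta>"
        by blast
      have "norm (f x - (u x + v x)) \<le> \<delta>" if "x \<in> {a..<c}" for x
        using that u(2,3)[of x] v(2,3)[of x] by (cases "x < b") auto
      moreover have "u x + v x = 0" if "x \<notin> {a..<c}" for x
        using that u(2)[of x] v(2)[of x] trans(3,4) by auto
      ultimately show "\<exists>w. well_sampled w \<and> (\<forall>x. x \<notin> {a..<c} \<longrightarrow> w x = 0) \<and>
         (\<forall>x\<in>{a..<c}. norm (f x - w x) \<le> \<delta>)"
        using well_sampled_add[OF u(1) v(1)] by blast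
    qed
  next
    fix x assume local: "0 \<le> x" "x \<le> 2 * pi"
    obtain l d where d: "d > 0" "\<And>y. 0 \<le> y \<Longrightarrow> x - d < y \<Longrightarrow> y < x \<Longrightarrow> norm (f y - l) \<le> \<delta>"
    proof (cases "x = 0")
      case False
      with local left obtain l where "(f \<longlongrightarrow> l) (at_left x)" by force
      from tendstoD[OF this \<delta>] obtain d where "d < x" "\<And>y. d < y \<Longrightarrow> y < x \<Longrightarrow> dist (f y) l < \<delta>"
        unfolding eventually_at_left_field by blast
      then show ?thesis by (intro that[of "x - d" l]) (force simp: dist_norm less_imp_le)+
    qed (use that[of 1] in force)
    obtain r e where e: "e > 0" "\<And>y. y < 2 * pi \<Longrightarrow> x < y \<Longrightarrow> y < x + e \<Longrightarrow> norm (f y - r) \<le> \<delta>"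
    proof (cases "x = 2 * pi")
      case False
      with local right obtain r where "(f \<longlongrightarrow> r) (at_right x)" by force
      from tendstoD[OF this \<delta>] obtain d where "d > x" "\<And>y. x < y \<Longrightarrow> y < d \<Longrightarrow> dist (f y) r < \<delta>"
        unfolding eventually_at_right_field by blast
      then show ?thesis by (intro that[of "d - x" r]) (force simp: dist_norm less_imp_le)+
    qed (use that[of 1] in force)
    show "\<exists>d>0. \<forall>a b. a \<le> x \<and> x \<le> b \<and> b - a < d \<longrightarrow> P a b"
    proof (intro exI conjI allI impI)
      show "min d e > 0" using d e by simp
      fix a b assume ab: "a \<le> x \<and> x \<le> b \<and> b - a < min d e"
      show "P a b" unfolding P_def
      proof (intro impI)
        assume ab': "0 \<le> a \<and> b \<le> 2 * pi"
        define step where "step = (\<lambda>(p::real) x. if x < p then 1 else (0::complex))"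
        define u where "u = (\<lambda>y. (l * step x y + (- l) * step a y) + (r * step b y + (- r) * step x y)
           + (if x < b then f x - r else 0) * (if y = x then 1 else 0))"
        have "well_sampled u"
          unfolding u_def step_def using ab ab' local
          by (intro well_sampled_add well_sampled_cmult well_sampled_step well_sampled_point) auto
        moreover have "u y = 0" if "y \<notin> {a..<b}" for y
          using that ab by (auto simp: u_def step_def)
        moreover have "norm (f y - u y) \<le> \<delta>" if "y \<in> {a..<b}" for y
          using that ab ab' d(2)[of y] e(2)[of y] \<delta>
          by (cases y x rule: linorder_cases) (auto simp: u_def step_def)
        ultimately show "\<exists>u. well_sampled u \<and> (\<forall>x. x \<notin> {a..<b} \<longrightarrow> u x = 0) \<and>
           (\<forall>x\<in>{a..<b}. norm (f x - u x) \<le> \<delta>)" by blast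
      qed
    qed
  qed auto
  then obtain u where u: "well_sampled u" "\<And>x. x \<in> {0..<2 * pi} \<Longrightarrow> norm (f x - u x) \<le> \<delta>"
    "u (2 * pi) = 0"
    unfolding P_def by auto
  show thesis
  proof (rule that)
    show "well_sampled (\<lambda>x. u x + f (2 * pi) * (if x = 2 * pi then 1 else 0))"
      by (intro well_sampled_add well_sampled_cmult well_sampled_point u)
    show "norm (f x - (u x + f (2 * pi) * (if x = 2 * pi then 1 else 0))) \<le> \<delta>"
      if "x \<in> {0..2 * pi}" for x
      using that u \<delta> by (cases "x = 2 * pi") auto
  qed
qed

lemma fourier_integrable_limit:
  fixes f :: "real \<Rightarrow> complex"
  assumes "\<And>\<delta>. \<delta> > 0 \<Longrightarrow> \<exists>u. fourier_integrable u \<and> (\<forall>x\<in>{0..2 * pi}. norm (f x - u x) \<le> \<delta>)"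
  shows "fourier_integrable f"
  unfolding fourier_integrable_def
proof
  fix d
  have "(\<lambda>x. f x * wave d x) integrable_on cbox 0 (2 * pi)"
  proof (rule integrable_uniform_limit)
    fix \<delta> :: real assume "\<delta> > 0"
    from assms[OF this] obtain u where u: "fourier_integrable u" "\<And>x. x \<in> {0..2 * pi} \<Longrightarrow> norm (f x - u x) \<le> \<delta>"
      by blast
    have "norm (f x * wave d x - u x * wave d x) \<le> \<delta>" if "x \<in> cbox 0 (2 * pi)" for x
    proof -
      have "norm (f x * wave d x - u x * wave d x) = norm ((f x - u x) * wave d x)"
        by (simp add: left_diff_distrib)
      then show ?thesis using u(2)[of x] that by (simp add: norm_mult)
    qed
    then show "\<exists>g. (\<forall>x\<in>cbox 0 (2 * pi). norm (f x * wave d x - g x) \<le> \<delta>) \<and> g integrable_on cbox 0 (2 * pi)"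
      using u(1) unfolding fourier_integrable_def by (intro exI[of _ "\<lambda>x. u x * wave d x"]) auto
  qed
  then show "(\<lambda>x. f x * wave d x) integrable_on {0..2 * pi}" by simp
qed

text \<open>The values alone could accumulate at zero near a jump; the one-sided limits being nonzero prevents
  this locally, and bisection makes the bound uniform.\<close>

lemma bounded_away_from_zero:
  fixes f :: "real \<Rightarrow> complex"
  assumes right: "\<And>x. 0 \<le> x \<Longrightarrow> x < 2 * pi \<Longrightarrow> \<exists>r. (f \<longlongrightarrow> r) (at_right x)"
    and left: "\<And>x. 0 < x \<Longrightarrow> x \<le> 2 * pi \<Longrightarrow> \<exists>l. (f \<longlongrightarrow> l) (at_left x)"
    and nz: "without_zeros f"
  obtains c where "c > 0" "\<And>x. x \<in> {0..2 * pi} \<Longrightarrow> c \<le> norm (f x)"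
proof -
  define P where "P a b \<longleftrightarrow> (0 \<le> a \<and> b \<le> 2 * pi \<longrightarrow> (\<exists>c>0. \<forall>x\<in>{a..b}. c \<le> norm (f x)))" for a b :: real
  have "P 0 (2 * pi)"
  proof (rule Bolzano)
    fix a b c assume trans: "P a b" "P b c" "a \<le> b" "b \<le> c"
    show "P a c" unfolding P_def
    proof (intro impI)
      assume "0 \<le> a \<and> c \<le> 2 * pi"
      then have ab: "0 \<le> a \<and> b \<le> 2 * pi" and bc: "0 \<le> b \<and> c \<le> 2 * pi"
        using trans(3,4) by auto
      from trans(1)[unfolded P_def, rule_format, OF ab] obtain s where
        s: "s > 0" "\<And>x. x \<in> {a..b} \<Longrightarrow> s \<le> norm (f x)"
        by blast
      from trans(2)[unfolded P_def, rule_format, OF bc] obtain t where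
        t: "t > 0" "\<And>x. x \<in> {b..c} \<Longrightarrow> t \<le> norm (f x)"
        by blast
      have "min s t \<le> norm (f x)" if "x \<in> {a..c}" for x
        using that s(2)[of x] t(2)[of x] by (cases "x \<le> b") auto
      then show "\<exists>s>0. \<forall>x\<in>{a..c}. s \<le> norm (f x)"
        using s(1) t(1) by (intro exI[of _ "min s t"]) auto
    qed
  next
    fix x assume local: "0 \<le> x" "x \<le> 2 * pi"
    have fx: "norm (f x) > 0" using nz by (simp add: without_zeros_def)
    obtain l d where d: "l > 0" "d > 0" "\<And>y. 0 \<le> y \<Longrightarrow> x - d < y \<Longrightarrow> y < x \<Longrightarrow> l \<le> norm (f y)"
    proof (cases "x = 0")
      case False
      with local left obtain l where l: "(f \<longlongrightarrow> l) (at_left x)" by force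
      then have "l \<noteq> 0" using nz by (auto simp: without_zeros_def)
      then have "eventually (\<lambda>y. norm l / 2 < norm (f y)) (at_left x)"
        using order_tendstoD(1)[OF tendsto_norm[OF l], of "norm l / 2"] by simp
      then obtain d where "d < x" "\<And>y. d < y \<Longrightarrow> y < x \<Longrightarrow> norm l / 2 < norm (f y)"
        unfolding eventually_at_left_field by blast
      then show ?thesis using \<open>l \<noteq> 0\<close> by (intro that[of "norm l / 2" "x - d"]) (force simp: less_imp_le)+
    qed (use that[of 1 1] in force)
    obtain r e where e: "r > 0" "e > 0" "\<And>y. y \<le> 2 * pi \<Longrightarrow> x < y \<Longrightarrow> y < x + e \<Longrightarrow> r \<le> norm (f y)"
    proof (cases "x = 2 * pi")
      case False
      with local right obtain l where l: "(f \<longlongrightarrow> l) (at_right x)" by force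
      then have "l \<noteq> 0" using nz by (auto simp: without_zeros_def)
      then have "eventually (\<lambda>y. norm l / 2 < norm (f y)) (at_right x)"
        using order_tendstoD(1)[OF tendsto_norm[OF l], of "norm l / 2"] by simp
      then obtain d where "d > x" "\<And>y. x < y \<Longrightarrow> y < d \<Longrightarrow> norm l / 2 < norm (f y)"
        unfolding eventually_at_right_field by blast
      then show ?thesis using \<open>l \<noteq> 0\<close> by (intro that[of "norm l / 2" "d - x"]) (force simp: less_imp_le)+
    qed (use that[of 1 1] in force)
    show "\<exists>d>0. \<forall>a b. a \<le> x \<and> x \<le> b \<and> b - a < d \<longrightarrow> P a b"
    proof (intro exI conjI allI impI)
      show "min d e > 0" using d e by simp
      fix a b assume ab: "a \<le> x \<and> x \<le> b \<and> b - a < min d e"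
      show "P a b" unfolding P_def
      proof (intro impI)
        assume ab': "0 \<le> a \<and> b \<le> 2 * pi"
        have "min (norm (f x)) (min l r) \<le> norm (f y)" if "y \<in> {a..b}" for y
          using that ab ab' d(3)[of y] e(3)[of y] by (cases y x rule: linorder_cases) auto
        then show "\<exists>c>0. \<forall>x\<in>{a..b}. c \<le> norm (f x)"
          using fx d(1) e(1) by (intro exI[of _ "min (norm (f x)) (min l r)"]) auto
      qed
    qed
  qed auto
  then show thesis using that unfolding P_def by auto
qed

section \<open>Sesquilinear forms of Toeplitz and circulant matrices\<close>

text \<open>Vectors and matrices are plain functions here, so that the estimates are statements about finite
  sums; only the entries with indices below \<open>n\<close> matter.\<close>

definition sq_norm :: "nat \<Rightarrow> (nat \<Rightarrow> complex) \<Rightarrow> real" where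
  "sq_norm n x = (\<Sum>k<n. (norm (x k))\<^sup>2)"

definition trig_poly :: "nat \<Rightarrow> (nat \<Rightarrow> complex) \<Rightarrow> real \<Rightarrow> complex" where
  "trig_poly n x t = (\<Sum>k<n. x k * wave (int k) t)"

definition sesq_form :: "nat \<Rightarrow> (nat \<Rightarrow> nat \<Rightarrow> complex) \<Rightarrow> (nat \<Rightarrow> complex) \<Rightarrow> (nat \<Rightarrow> complex) \<Rightarrow> complex" where
  "sesq_form n A y x = (\<Sum>j<n. \<Sum>k<n. cnj (y j) * A j k * x k)"

lemma cnj_trig_poly_mult:
  "cnj (trig_poly n y t) * trig_poly n x t = (\<Sum>j<n. \<Sum>k<n. cnj (y j) * x k * wave (- (int j - int k)) t)"
  unfolding trig_poly_def cnj_sum sum_product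
  by (intro sum.cong refl) (simp add: cnj_wave flip: wave_add)

lemma sesq_form_identity: "sesq_form n (\<lambda>j k. if j = k then 1 else 0) x x = complex_of_real (sq_norm n x)"
proof -
  have "sesq_form n (\<lambda>j k. if j = k then 1 else 0) x x = (\<Sum>j<n. \<Sum>k<n. if j = k then cnj (x j) * x j else 0)"
    unfolding sesq_form_def by (intro sum.cong refl) auto
  also have "\<dots> = (\<Sum>j<n. cnj (x j) * x j)" by simp
  finally show ?thesis by (simp add: sq_norm_def complex_norm_square[symmetric] mult.commute)
qed

text \<open>This turns a quadratic expression in a Toeplitz matrix into an integral against the symbol, from
  which bounds in terms of the supremum of the symbol can be read off. The counterpart for circulant
  matrices is \<open>circulant_form\<close>, with the integral replaced by the mean over the grid.\<close>

lemma has_integral_toeplitz_form: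
  assumes "fourier_integrable g"
  shows "((\<lambda>t. g t * (cnj (trig_poly n y t) * trig_poly n x t)) has_integral
     2 * pi * sesq_form n (\<lambda>j k. fourier_coeff g (int j - int k)) y x) {0..2 * pi}"
proof -
  have "((\<lambda>t. g t * wave (- d) t) has_integral 2 * pi * fourier_coeff g d) {0..2 * pi}" for d
    using assms by (simp add: fourier_integrable_def fourier_coeff_def has_integral_iff)
  then have "((\<lambda>t. \<Sum>j<n. \<Sum>k<n. cnj (y j) * x k * (g t * wave (- (int j - int k)) t)) has_integral
      (\<Sum>j<n. \<Sum>k<n. cnj (y j) * x k * (2 * pi * fourier_coeff g (int j - int k)))) {0..2 * pi}"
    by (intro has_integral_sum has_integral_mult_right) (simp_all del: minus_diff_eq)
  then show ?thesis
    unfolding cnj_trig_poly_mult sesq_form_def by (simp add: sum_distrib_left mult_ac)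
qed

lemma fourier_integrable_1: "fourier_integrable (\<lambda>_. 1)"
  unfolding fourier_integrable_def by (auto intro!: integrable_continuous_real continuous_intros)

lemma fourier_coeff_1: "fourier_coeff (\<lambda>_. 1) d = (if d = 0 then 1 else 0)"
  using integral_unique[OF has_integral_wave[of "2 * pi" d]] by (simp add: fourier_coeff_def wave_2pi)

lemma sampled_coeff_1:
  assumes "\<bar>d\<bar> < int n"
  shows "sampled_coeff n (\<lambda>_. 1) d = (if d = 0 then 1 else 0)"
proof (cases "d = 0")
  case True
  then show ?thesis using assms by (simp add: sampled_coeff_def)
next
  case False
  define \<theta> where "\<theta> = of_int d * 2 * pi / real n"
  define w where "w = exp (- (\<i> * complex_of_real \<theta>))"
  have n: "n > 0" using assms by auto
  have "\<bar>real_of_int d\<bar> < real n" using assms by linarith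
  then have "\<theta> \<noteq> 0" "\<bar>\<theta>\<bar> < 2 * pi" using False n by (auto simp: \<theta>_def abs_mult field_simps)
  then have w: "w \<noteq> 1" using exp_i_secant_error(2) by (simp add: w_def)
  have "w ^ n = wave (- d) (grid_point n n)" by (simp add: wave_grid_point w_def \<theta>_def)
  also have "grid_point n n = 2 * pi" using n by (simp add: grid_point_def)
  finally have "w ^ n = 1" by (simp add: wave_2pi)
  then have "(\<Sum>l<n. w ^ l) = 0" using w by (simp add: sum_gp_strict)
  then show ?thesis
    using False by (simp add: sampled_coeff_def wave_grid_point w_def \<theta>_def)
qed

text \<open>Parseval's identity is the case of the constant symbol, whose Toeplitz matrix is the identity.\<close>

lemma trig_poly_Parseval: "((\<lambda>t. (norm (trig_poly n x t))\<^sup>2) has_integral 2 * pi * sq_norm n x) {0..2 * pi}"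
proof -
  have "(\<lambda>j k. fourier_coeff (\<lambda>_. 1) (int j - int k)) = (\<lambda>j k. if j = k then 1 else 0)"
    by (auto simp: fourier_coeff_1 fun_eq_iff)
  then have "((\<lambda>t. complex_of_real ((norm (trig_poly n x t))\<^sup>2)) has_integral complex_of_real (2 * pi * sq_norm n x)) {0..2 * pi}"
    using has_integral_toeplitz_form[OF fourier_integrable_1, of n x x]
    by (simp add: sesq_form_identity complex_norm_square[symmetric] mult.commute)
  from has_integral_Re[OF this] show ?thesis by simp
qed

lemma circulant_form:
  assumes "n > 0"
  shows "(\<Sum>l<n. g (grid_point n l) * (cnj (trig_poly n y (grid_point n l)) * trig_poly n x (grid_point n l))) =
     n * sesq_form n (\<lambda>j k. sampled_coeff n g (int j - int k)) y x"
proof -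
  have "(\<Sum>l<n. g (grid_point n l) * (cnj (trig_poly n y (grid_point n l)) * trig_poly n x (grid_point n l))) =
    (\<Sum>l<n. \<Sum>j<n. \<Sum>k<n. cnj (y j) * x k * (g (grid_point n l) * wave (- (int j - int k)) (grid_point n l)))"
    unfolding cnj_trig_poly_mult sum_distrib_left by (simp add: mult_ac)
  also have "\<dots> = (\<Sum>j<n. \<Sum>l<n. \<Sum>k<n. cnj (y j) * x k * (g (grid_point n l) * wave (- (int j - int k)) (grid_point n l)))"
    by (rule sum.swap)
  also have "\<dots> = (\<Sum>j<n. \<Sum>k<n. \<Sum>l<n. cnj (y j) * x k * (g (grid_point n l) * wave (- (int j - int k)) (grid_point n l)))"
    by (intro sum.cong refl sum.swap)
  also have "\<dots> = (\<Sum>j<n. \<Sum>k<n. of_nat n * (cnj (y j) * sampled_coeff n g (int j - int k) * x k))"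
    using assms by (intro sum.cong refl) (simp add: sampled_coeff_def sum_distrib_left[symmetric] mult_ac)
  finally show ?thesis by (simp add: sesq_form_def sum_distrib_left)
qed

lemma trig_poly_sampled_Parseval:
  assumes "n > 0"
  shows "(\<Sum>l<n. (norm (trig_poly n x (grid_point n l)))\<^sup>2) = n * sq_norm n x"
proof -
  have "sesq_form n (\<lambda>j k. sampled_coeff n (\<lambda>_. 1) (int j - int k)) x x = sesq_form n (\<lambda>j k. if j = k then 1 else 0) x x"
    unfolding sesq_form_def by (intro sum.cong refl) (auto simp: sampled_coeff_1)
  then have "complex_of_real (\<Sum>l<n. (norm (trig_poly n x (grid_point n l)))\<^sup>2) = complex_of_real (n * sq_norm n x)"
    using circulant_form[OF assms, of "\<lambda>_. 1" x x]
    by (simp add: sesq_form_identity complex_norm_square[symmetric] mult.commute)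
  then show ?thesis by (simp only: of_real_eq_iff)
qed

lemma norm_weighted_product_le:
  fixes a x y :: complex
  assumes "norm a \<le> \<delta>"
  shows "norm (a * (cnj y * x)) \<le> \<delta> / 2 * ((norm x)\<^sup>2 + (norm y)\<^sup>2)"
proof -
  have "2 * (norm y * norm x) \<le> (norm x)\<^sup>2 + (norm y)\<^sup>2"
    using sum_squares_bound[of "norm x" "norm y"] by (simp add: mult_ac)
  then have "\<delta> * (norm y * norm x) \<le> \<delta> / 2 * ((norm x)\<^sup>2 + (norm y)\<^sup>2)"
    using mult_left_mono[of _ _ "\<delta> / 2"] assms norm_ge_zero[of a] by fastforce
  moreover have "norm (a * (cnj y * x)) \<le> \<delta> * (norm y * norm x)"
    using assms by (simp add: norm_mult mult_right_mono)
  ultimately show ?thesis by linarith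
qed

text \<open>The arithmetic-geometric mean inequality under the integral sign replaces the Cauchy-Schwarz
  inequality; for vectors of norm at most 1 the resulting bound is still \<open>\<delta>\<close>.\<close>

lemma toeplitz_form_bound:
  assumes "fourier_integrable g" "\<And>t. t \<in> {0..2 * pi} \<Longrightarrow> norm (g t) \<le> \<delta>"
  shows "norm (sesq_form n (\<lambda>j k. fourier_coeff g (int j - int k)) y x) \<le> \<delta> / 2 * (sq_norm n x + sq_norm n y)"
proof -
  note * = has_integral_toeplitz_form[OF assms(1), of n y x]
  have bound: "((\<lambda>t. \<delta> / 2 * ((norm (trig_poly n x t))\<^sup>2 + (norm (trig_poly n y t))\<^sup>2)) has_integral
     \<delta> / 2 * (2 * pi * sq_norm n x + 2 * pi * sq_norm n y)) {0..2 * pi}"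
    by (intro has_integral_mult_right has_integral_add trig_poly_Parseval)
  have "norm (integral {0..2 * pi} (\<lambda>t. g t * (cnj (trig_poly n y t) * trig_poly n x t))) \<le>
      integral {0..2 * pi} (\<lambda>t. \<delta> / 2 * ((norm (trig_poly n x t))\<^sup>2 + (norm (trig_poly n y t))\<^sup>2))"
    using * bound by (intro integral_norm_bound_integral norm_weighted_product_le assms(2)) auto
  then have "2 * pi * norm (sesq_form n (\<lambda>j k. fourier_coeff g (int j - int k)) y x) \<le>
      2 * pi * (\<delta> / 2 * (sq_norm n x + sq_norm n y))"
    unfolding integral_unique[OF *] integral_unique[OF bound]
    by (simp add: norm_mult field_simps)
  then show ?thesis by simp
qed

lemma circulant_form_bound:
  assumes "\<And>t. t \<in> {0..2 * pi} \<Longrightarrow> norm (g t) \<le> \<delta>"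
  shows "norm (sesq_form n (\<lambda>j k. sampled_coeff n g (int j - int k)) y x) \<le> \<delta> / 2 * (sq_norm n x + sq_norm n y)"
proof (cases "n = 0")
  case False
  have grid_point: "grid_point n l \<in> {0..2 * pi}" if "l < n" for l
    using that by (auto simp: grid_point_def field_simps)
  have "norm (\<Sum>l<n. g (grid_point n l) * (cnj (trig_poly n y (grid_point n l)) * trig_poly n x (grid_point n l))) \<le>
     (\<Sum>l<n. \<delta> / 2 * ((norm (trig_poly n x (grid_point n l)))\<^sup>2 + (norm (trig_poly n y (grid_point n l)))\<^sup>2))"
    by (intro sum_norm_le norm_weighted_product_le assms grid_point) auto
  also have "\<dots> = n * (\<delta> / 2 * (sq_norm n x + sq_norm n y))"
    using False by (simp only: sum_distrib_left[symmetric] sum.distrib trig_poly_sampled_Parseval)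
      (simp add: algebra_simps trig_poly_sampled_Parseval)
  finally show ?thesis
    using False by (simp add: circulant_form norm_mult)
qed (simp add: sesq_form_def sq_norm_def)

section \<open>Unitary matrices exhibiting the eigenvalues\<close>

lemma dim_mat_adjoint [simp]:
  "dim_row (mat_adjoint A) = dim_col A" "dim_col (mat_adjoint A) = dim_row A"
  by (simp_all add: mat_adjoint_def)

lemma mat_adjoint_carrier:
  "A \<in> carrier_mat n m \<Longrightarrow> mat_adjoint A \<in> carrier_mat m n"
  by (intro carrier_matI) auto

lemma mat_adjoint_index:
  assumes "A \<in> carrier_mat n m" "i < m" "j < n"
  shows "mat_adjoint A $$ (i, j) = conjugate (A $$ (j, i))"
  using assms by (auto simp: mat_adjoint_def mat_of_rows_index)

lemma mat_adjoint_mult: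
  fixes A B :: "complex mat"
  assumes A: "A \<in> carrier_mat n m" and B: "B \<in> carrier_mat m k"
  shows "mat_adjoint (A * B) = mat_adjoint B * mat_adjoint A"
proof (rule eq_matI)
  note adj = mat_adjoint_carrier[OF A] mat_adjoint_carrier[OF B] mat_adjoint_carrier[OF mult_carrier_mat[OF A B]]
  fix i j assume "i < dim_row (mat_adjoint B * mat_adjoint A)" "j < dim_col (mat_adjoint B * mat_adjoint A)"
  then have ij: "i < k" "j < n" using adj by auto
  have "mat_adjoint (A * B) $$ (i, j) = cnj (\<Sum>l<m. A $$ (j, l) * B $$ (l, i))"
    using mat_adjoint_index[OF mult_carrier_mat[OF A B], of i j] ij A B
    by (simp add: scalar_prod_def atLeast0LessThan)
  also have "\<dots> = (mat_adjoint B * mat_adjoint A) $$ (i, j)"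
    using ij A B adj mat_adjoint_index[OF A] mat_adjoint_index[OF B]
    by (simp add: scalar_prod_def atLeast0LessThan mult.commute)
  finally show "mat_adjoint (A * B) $$ (i, j) = (mat_adjoint B * mat_adjoint A) $$ (i, j)" .
qed (use A B in \<open>auto simp: mat_adjoint_def\<close>)

text \<open>The columns are the normalised Gram-Schmidt vectors of a basis that starts with \<open>v\<close>.\<close>

lemma unitary_with_first_column:
  fixes v :: "complex vec"
  assumes v: "v \<in> carrier_vec n" and v0: "v \<noteq> 0\<^sub>v n" and n: "n > 0"
  obtains W c where "W \<in> carrier_mat n n" "mat_adjoint W * W = 1\<^sub>m n" "col W 0 = c \<cdot>\<^sub>v v"
proof -
  interpret cof_vec_space n "TYPE(complex)" .
  define b where "b = basis_completion v"
  define ws where "ws = gram_schmidt n b"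
  note bc = basis_completion[OF v v0, folded b_def]
  have b: "set b \<subseteq> carrier_vec n" "distinct b" "\<not> lin_dep (set b)" "hd b = v" "length b = n"
    using bc by auto
  then obtain vs where bv: "b = v # vs" using n by (cases b) auto
  from gram_schmidt_result[OF b(1,2,3) refl, folded ws_def]
  have ws: "set ws \<subseteq> carrier_vec n" "corthogonal ws" "length ws = n" by (auto simp: b(5))
  have ws0: "ws ! 0 = v"
    using gram_schmidt_hd[OF v, of vs, folded bv] ws(3) n unfolding ws_def by (cases "gram_schmidt n b") auto
  have wsc: "ws ! i \<in> carrier_vec n" if "i < n" for i using ws that by auto
  define r where "r i = 1 / complex_of_real (sqrt (Re (ws ! i \<bullet>c ws ! i)))" for i
  define W where "W = mat_of_cols n (map (\<lambda>i. r i \<cdot>\<^sub>v ws ! i) [0..<n])"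
  have W: "W \<in> carrier_mat n n" unfolding W_def by (intro carrier_matI) auto
  have W_index: "W $$ (k, i) = r i * vec_index (ws ! i) k" if "k < n" "i < n" for k i
    using that wsc[OF that(2)] by (simp add: W_def mat_of_cols_index)
  have "mat_adjoint W * W = 1\<^sub>m n"
  proof (rule eq_matI)
    fix i j assume "i < dim_row (1\<^sub>m n)" "j < dim_col (1\<^sub>m n)"
    then have ij: "i < n" "j < n" by auto
    have "(mat_adjoint W * W) $$ (i, j) = (\<Sum>k<n. cnj (W $$ (k, i)) * W $$ (k, j))"
      using ij W mat_adjoint_carrier[OF W] mat_adjoint_index[OF W]
      by (simp add: scalar_prod_def atLeast0LessThan)
    also have "\<dots> = cnj (r i) * r j * (ws ! j \<bullet>c ws ! i)"
      using ij wsc[OF ij(1)] wsc[OF ij(2)]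
      by (simp add: W_index scalar_prod_def atLeast0LessThan sum_distrib_left mult_ac)
    also have "\<dots> = (if i = j then 1 else 0)"
    proof (cases "i = j")
      case False
      then show ?thesis using corthogonalD[OF ws(2), of j i] ij ws(3) by simp
    next
      case True
      define s where "s = (\<Sum>k<n. (norm (vec_index (ws ! i) k))\<^sup>2)"
      have s: "ws ! i \<bullet>c ws ! i = complex_of_real s"
        using wsc[OF ij(1)]
        by (simp add: s_def scalar_prod_def atLeast0LessThan complex_norm_square[symmetric] del: of_real_power)
      have "s \<noteq> 0" using corthogonalD[OF ws(2), of i i] ij ws(3) s by auto
      moreover have "s \<ge> 0" by (simp add: s_def sum_nonneg)
      ultimately have "complex_of_real (sqrt s) * complex_of_real (sqrt s) = complex_of_real s" "s > 0"
        by (simp_all flip: of_real_mult)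
      then show ?thesis unfolding True[symmetric] r_def s by (simp add: field_simps)
    qed
    finally show "(mat_adjoint W * W) $$ (i, j) = 1\<^sub>m n $$ (i, j)" using ij by simp
  qed (use W mat_adjoint_carrier[OF W] in auto)
  moreover have col0: "col W 0 = r 0 \<cdot>\<^sub>v v"
    using n wsc[OF n] v unfolding W_def by (subst col_mat_of_cols) (auto simp: ws0)
  ultimately show thesis using that[OF W] by blast
qed

lemma prod_list_linear_factors_nonzero: "(\<Prod>e\<leftarrow>es. [:- e, 1:]) \<noteq> (0 :: complex poly)"
  by (induction es) (simp_all del: mult_pCons_left)

text \<open>This is the part of Schur's triangularisation that is needed: the eigenvalues, with
  multiplicity, are the diagonal entries in some orthonormal basis. Unitarity matters because
  Frobenius norms have to survive the change of basis. Taking a unit eigenvector as first column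
  of a unitary \<open>W\<close> splits off one eigenvalue, and the induction continues in the lower right block.\<close>

lemma unitary_diagonal_eigenvalues:
  fixes A :: "complex mat"
  assumes "A \<in> carrier_mat n n" "char_poly A = (\<Prod>e\<leftarrow>es. [:- e, 1:])"
  shows "\<exists>U\<in>carrier_mat n n. mat_adjoint U * U = 1\<^sub>m n \<and> diag_mat (mat_adjoint U * A * U) = es"
  using assms
proof (induction es arbitrary: n A)
  case Nil
  then have "n = 0" using degree_monic_char_poly[OF Nil(1)] by simp
  then show ?case using Nil
    by (intro bexI[of _ "1\<^sub>m 0"]) (auto simp: diag_mat_def mat_adjoint_def intro!: eq_matI)
next
  case (Cons e es n A)
  note A = Cons.prems(1)
  have "eigenvalue A e"
    unfolding eigenvalue_root_char_poly[OF A] Cons.prems(2) by simp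
  then obtain v where "eigenvector A v e" unfolding eigenvalue_def by blast
  then have v: "v \<in> carrier_vec n" "v \<noteq> 0\<^sub>v n" "A *\<^sub>v v = e \<cdot>\<^sub>v v"
    using A unfolding eigenvector_def by auto
  have "degree (char_poly A) = Suc (degree (\<Prod>e\<leftarrow>es. [:- e, 1:]))"
    unfolding Cons.prems(2) list.map prod_list.Cons by (subst degree_mult_eq) (use prod_list_linear_factors_nonzero in auto)
  then have n: "n > 0" using degree_monic_char_poly[OF A] by simp
  define m where "m = n - 1"
  have nm: "n = 1 + m" using n by (simp add: m_def)
  obtain W c where W: "W \<in> carrier_mat n n" and WW: "mat_adjoint W * W = 1\<^sub>m n" and W0: "col W 0 = c \<cdot>\<^sub>v v"
    using unitary_with_first_column[OF v(1,2) n] by blast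
  note W' = mat_adjoint_carrier[OF W]
  have WW': "W * mat_adjoint W = 1\<^sub>m n" by (rule mat_mult_left_right_inverse[OF W' W WW])
  define A' where "A' = mat_adjoint W * A * W"
  have A': "A' \<in> carrier_mat n n" using W W' A unfolding A'_def by simp
  have "similar_mat_wit A' A (mat_adjoint W) W"
    by (rule similar_mat_witI[OF WW WW']) (use A A' W W' in \<open>auto simp: A'_def\<close>)
  then have sim: "similar_mat A' A" unfolding similar_mat_def by blast
  have col0: "A' $$ (i, 0) = (if i = 0 then e else 0)" if i: "i < n" for i
  proof -
    have "col (A * W) 0 = A *\<^sub>v col W 0" using A W n by auto
    also have "\<dots> = e \<cdot>\<^sub>v col W 0"
      unfolding W0 using A v by (simp add: mult_mat_vec smult_smult_assoc mult.commute)
    finally have col: "col (A * W) 0 = e \<cdot>\<^sub>v col W 0" .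
    have "A' $$ (i, 0) = (mat_adjoint W * (A * W)) $$ (i, 0)"
      unfolding A'_def using W W' A by simp
    also have "\<dots> = row (mat_adjoint W) i \<bullet> col (A * W) 0"
      using W W' A i n by simp
    also have "\<dots> = e * (row (mat_adjoint W) i \<bullet> col W 0)"
      unfolding col using W W' i n by (simp add: scalar_prod_smult_distrib[of _ n])
    also have "row (mat_adjoint W) i \<bullet> col W 0 = (mat_adjoint W * W) $$ (i, 0)"
      using W W' i n by simp
    finally show ?thesis unfolding WW using i n by simp
  qed
  obtain A1 A2 A0 A3 where split: "split_block A' 1 1 = (A1, A2, A0, A3)"
    by (cases "split_block A' 1 1") auto
  have "dim_row A' = 1 + m" "dim_col A' = 1 + m" using A' nm by auto
  note blk = split_block[OF split this]
  have A1: "A1 = Matrix.mat 1 1 (\<lambda>_. e)" and A0: "A0 = 0\<^sub>m m 1"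
    using split[unfolded split_block_def Let_def] A' nm col0 by (auto intro!: eq_matI)
  have A1c: "A1 \<in> carrier_mat 1 1" using A1 by simp
  note A2 = blk(2) and A3 = blk(4)
  have "char_poly A' = char_poly A1 * char_poly A3"
    unfolding blk(5) A0 by (rule char_poly_four_block_zeros_col[OF A1c A2 A3])
  also have "char_poly A1 = [:- e, 1:]"
    by (simp add: A1 char_poly_defs det_def sign_def)
  also have "char_poly A' = [:- e, 1:] * (\<Prod>e\<leftarrow>es. [:- e, 1:])"
    using char_poly_similar[OF sim] Cons.prems(2) by simp
  finally have "char_poly A3 = (\<Prod>e\<leftarrow>es. [:- e, 1:])"
    by (metis mult_cancel_left pCons_eq_0_iff zero_neq_one)
  from Cons.IH[OF A3 this] obtain U where U: "U \<in> carrier_mat m m" and UU: "mat_adjoint U * U = 1\<^sub>m m"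
    and diag: "diag_mat (mat_adjoint U * A3 * U) = es" by blast
  note U' = mat_adjoint_carrier[OF U]
  define V where "V = four_block_mat (1\<^sub>m 1) (0\<^sub>m 1 m) (0\<^sub>m m 1) U"
  have V: "V \<in> carrier_mat n n"
    using U unfolding V_def nm by (intro four_block_carrier_mat) auto
  have V': "mat_adjoint V = four_block_mat (1\<^sub>m 1) (0\<^sub>m 1 m) (0\<^sub>m m 1) (mat_adjoint U)"
  proof (rule eq_matI)
    fix i j
    assume "i < dim_row (four_block_mat (1\<^sub>m 1) (0\<^sub>m 1 m) (0\<^sub>m m 1) (mat_adjoint U))"
      "j < dim_col (four_block_mat (1\<^sub>m 1) (0\<^sub>m 1 m) (0\<^sub>m m 1) (mat_adjoint U))"
    then have ij: "i < n" "j < n" using U by (auto simp: nm)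
    have "V $$ (j, i) = (if j = 0 then if i = 0 then 1 else 0 else if i = 0 then 0 else U $$ (j - 1, i - 1))"
      using ij U by (auto simp: V_def nm)
    then show "mat_adjoint V $$ (i, j) =
       four_block_mat (1\<^sub>m 1) (0\<^sub>m 1 m) (0\<^sub>m m 1) (mat_adjoint U) $$ (i, j)"
      using ij U unfolding mat_adjoint_index[OF V ij] by (auto simp: nm mat_adjoint_index[OF U])
  qed (use U V in \<open>auto simp: nm\<close>)
  have VV: "mat_adjoint V * V = 1\<^sub>m n"
    unfolding V' unfolding V_def
    by (subst mult_four_block_mat[of _ 1 1 _ m _ m _ _ 1 _ m]) (use U U' UU nm in auto)
  have U'A3: "mat_adjoint U * A3 \<in> carrier_mat m m" using U' A3 by simp
  have "mat_adjoint V * A' = four_block_mat A1 A2 (0\<^sub>m m 1) (mat_adjoint U * A3)"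
    unfolding V' blk(5) A0
      mult_four_block_mat[OF one_carrier_mat zero_carrier_mat zero_carrier_mat U' A1c A2 zero_carrier_mat A3]
    using A1c A2 A3 U'A3 by (simp add: right_mult_zero_mat[OF U'])
  then have "mat_adjoint V * A' * V = four_block_mat A1 (A2 * U) (0\<^sub>m m 1) (mat_adjoint U * A3 * U)"
    unfolding V_def
    using mult_four_block_mat[OF A1c A2 zero_carrier_mat U'A3 one_carrier_mat zero_carrier_mat zero_carrier_mat U]
      A1c A2 U mult_carrier_mat[OF U'A3 U] by (simp add: right_mult_zero_mat[OF U'A3])
  then have "diag_mat (mat_adjoint V * A' * V) = diag_mat A1 @ es"
    using diag_four_block_mat[OF A1c, of "mat_adjoint U * A3 * U" m] U U' A3 diag by simp
  also have "diag_mat A1 = [e]" by (simp add: A1 diag_mat_def)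
  finally have diagV: "diag_mat (mat_adjoint V * A' * V) = e # es" by simp
  note V'c = mat_adjoint_carrier[OF V]
  show ?case
  proof (intro bexI conjI)
    have adj: "mat_adjoint (W * V) = mat_adjoint V * mat_adjoint W" by (rule mat_adjoint_mult[OF W V])
    have "mat_adjoint (W * V) * (W * V) = mat_adjoint V * (mat_adjoint W * W) * V"
      unfolding adj using W W' V V'c by (simp add: assoc_mult_mat[of _ n n _ n _ n])
    then show "mat_adjoint (W * V) * (W * V) = 1\<^sub>m n"
      unfolding WW right_mult_one_mat[OF V'c] VV .
    have "mat_adjoint (W * V) * A * (W * V) = mat_adjoint V * A' * V"
      unfolding adj A'_def using W W' V V'c A by (simp add: assoc_mult_mat[of _ n n _ n _ n])
    then show "diag_mat (mat_adjoint (W * V) * A * (W * V)) = e # es" using diagV by simp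
    show "W * V \<in> carrier_mat n n" using W V by simp
  qed
qed

section \<open>Counting eigenvalues by a Frobenius norm\<close>

lemma sesq_form_eq_matrix:
  assumes "U \<in> carrier_mat n n" "M \<in> carrier_mat n n" "i < n"
  shows "(mat_adjoint U * M * U) $$ (i, i) = sesq_form n (\<lambda>j k. M $$ (j, k)) (\<lambda>k. U $$ (k, i)) (\<lambda>k. U $$ (k, i))"
proof -
  note U' = mat_adjoint_carrier[OF assms(1)]
  have "(mat_adjoint U * M * U) $$ (i, i) = (mat_adjoint U * (M * U)) $$ (i, i)"
    using assms U' by simp
  also have "\<dots> = (\<Sum>j<n. cnj (U $$ (j, i)) * (\<Sum>k<n. M $$ (j, k) * U $$ (k, i)))"
    using assms U' by (simp add: scalar_prod_def atLeast0LessThan mat_adjoint_index[OF assms(1)])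
  finally show ?thesis by (simp add: sesq_form_def sum_distrib_left mult.assoc)
qed

text \<open>The rows of a unitary matrix are orthonormal as well. Applied to every row \<open>a\<close> of a matrix, the
  identity says that its Frobenius norm can be computed in any orthonormal basis.\<close>

lemma unitary_sq_norm_sum:
  assumes U: "U \<in> carrier_mat n n" and UU: "mat_adjoint U * U = 1\<^sub>m n"
  shows "(\<Sum>i<n. (norm (\<Sum>k<n. a k * U $$ (k, i)))\<^sup>2) = sq_norm n a"
proof -
  note U' = mat_adjoint_carrier[OF U]
  have UU': "U * mat_adjoint U = 1\<^sub>m n" by (rule mat_mult_left_right_inverse[OF U' U UU])
  have row: "(\<Sum>i<n. U $$ (k, i) * cnj (U $$ (l, i))) = (if k = l then 1 else 0)" if "k < n" "l < n" for k l
  proof -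
    have "(\<Sum>i<n. U $$ (k, i) * cnj (U $$ (l, i))) = (U * mat_adjoint U) $$ (k, l)"
      using U U' that by (simp add: scalar_prod_def atLeast0LessThan mat_adjoint_index[OF U])
    then show ?thesis unfolding UU' using that by simp
  qed
  have "complex_of_real (\<Sum>i<n. (norm (\<Sum>k<n. a k * U $$ (k, i)))\<^sup>2) =
     (\<Sum>i<n. \<Sum>k<n. \<Sum>l<n. a k * cnj (a l) * (U $$ (k, i) * cnj (U $$ (l, i))))"
    by (simp add: complex_norm_square cnj_sum sum_product mult_ac del: of_real_power)
  also have "\<dots> = (\<Sum>k<n. \<Sum>i<n. \<Sum>l<n. a k * cnj (a l) * (U $$ (k, i) * cnj (U $$ (l, i))))"
    by (rule sum.swap)
  also have "\<dots> = (\<Sum>k<n. \<Sum>l<n. \<Sum>i<n. a k * cnj (a l) * (U $$ (k, i) * cnj (U $$ (l, i))))"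
    by (intro sum.cong refl sum.swap)
  also have "\<dots> = (\<Sum>k<n. \<Sum>l<n. if k = l then a k * cnj (a k) else 0)"
    by (intro sum.cong refl) (simp add: sum_distrib_left[symmetric] row)
  also have "\<dots> = complex_of_real (sq_norm n a)"
    by (simp add: sq_norm_def complex_norm_square del: of_real_power)
  finally show ?thesis by (simp only: of_real_eq_iff)
qed

text \<open>In the basis of \<open>unitary_diagonal_eigenvalues\<close> every eigenvalue in \<open>S\<close> is a value of the form at a
  unit vector \<open>x\<close>, and contributes at least \<open>s\<close> to the squared Frobenius norm of \<open>R\<close>. Those
  contributions add up to at most that norm by \<open>unitary_sq_norm_sum\<close>.\<close>

lemma num_eigenvalues_le:
  fixes s :: real
  assumes M: "M \<in> carrier_mat n n"
    and large: "\<And>x. sq_norm n x = 1 \<Longrightarrow> sesq_form n (\<lambda>j k. M $$ (j, k)) x x \<in> S \<Longrightarrow>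
       s \<le> sq_norm n (\<lambda>j. \<Sum>k<n. R j k * x k)"
  shows "num_eigenvalues_in M S * s \<le> (\<Sum>j<n. sq_norm n (R j))"
proof -
  obtain es where es: "char_poly M = (\<Prod>e\<leftarrow>es. [:- e, 1:])" and len: "length es = n"
    using char_poly_factorized[OF M] by blast
  obtain U where U: "U \<in> carrier_mat n n" and UU: "mat_adjoint U * U = 1\<^sub>m n"
    and diag: "diag_mat (mat_adjoint U * M * U) = es"
    using unitary_diagonal_eigenvalues[OF M es] by blast
  note U' = mat_adjoint_carrier[OF U]
  define x where "x i k = U $$ (k, i)" for i k
  have eig: "es ! i = sesq_form n (\<lambda>j k. M $$ (j, k)) (x i) (x i)" if "i < n" for i
  proof -
    have "es ! i = (mat_adjoint U * M * U) $$ (i, i)"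
      unfolding diag[symmetric] diag_mat_def using that U by simp
    moreover have "x i = (\<lambda>k. U $$ (k, i))" by (simp add: x_def fun_eq_iff)
    ultimately show ?thesis using sesq_form_eq_matrix[OF U M that] by (simp only:)
  qed
  have unit: "sq_norm n (x i) = 1" if i: "i < n" for i
  proof -
    have "complex_of_real (sq_norm n (x i)) = (mat_adjoint U * U) $$ (i, i)"
      using i U U' by (simp add: x_def sq_norm_def scalar_prod_def atLeast0LessThan mat_adjoint_index[OF U]
          complex_norm_square mult.commute del: of_real_power)
    then show ?thesis unfolding UU using i by simp
  qed
  have "proots (char_poly M) = mset es"
    unfolding es
  proof (induction es)
    case (Cons e es)
    have "proots ([:- e, 1:] * (\<Prod>e\<leftarrow>es. [:- e, 1:])) = proots [:- e, 1:] + proots (\<Prod>e\<leftarrow>es. [:- e, 1:])"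
      by (rule proots_mult) (use prod_list_linear_factors_nonzero in auto)
    then show ?case using Cons by (simp del: mult_pCons_left)
  qed simp
  then have "num_eigenvalues_in M S = length (filter (\<lambda>z. z \<in> S) es)"
    by (simp add: num_eigenvalues_in_def flip: mset_filter)
  also have "\<dots> = card {i. i < n \<and> es ! i \<in> S}"
    by (simp add: length_filter_conv_card len)
  finally have "num_eigenvalues_in M S * s = (\<Sum>i | i < n \<and> es ! i \<in> S. s)" by simp
  also have "\<dots> \<le> (\<Sum>i | i < n \<and> es ! i \<in> S. sq_norm n (\<lambda>j. \<Sum>k<n. R j k * x i k))"
    using large[OF unit] eig by (intro sum_mono) auto
  also have "\<dots> \<le> (\<Sum>i<n. sq_norm n (\<lambda>j. \<Sum>k<n. R j k * x i k))"
    by (intro sum_mono2) (auto simp: sq_norm_def sum_nonneg)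
  also have "\<dots> = (\<Sum>j<n. \<Sum>i<n. (norm (\<Sum>k<n. R j k * x i k))\<^sup>2)"
    unfolding sq_norm_def by (rule sum.swap)
  also have "\<dots> = (\<Sum>j<n. sq_norm n (R j))"
    using unitary_sq_norm_sum[OF U UU] by (simp add: x_def)
  finally show ?thesis .
qed

lemma sesq_form_Cauchy_Schwarz:
  "(norm (sesq_form n R y x))\<^sup>2 \<le> sq_norm n y * sq_norm n (\<lambda>j. \<Sum>k<n. R j k * x k)"
proof -
  have "norm (sesq_form n R y x) = norm (\<Sum>j<n. cnj (y j) * (\<Sum>k<n. R j k * x k))"
    by (simp add: sesq_form_def sum_distrib_left mult.assoc)
  also have "\<dots> \<le> (\<Sum>j<n. norm (y j) * norm (\<Sum>k<n. R j k * x k))"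
    by (intro sum_norm_le) (simp add: norm_mult)
  finally have "(norm (sesq_form n R y x))\<^sup>2 \<le> (\<Sum>j<n. norm (y j) * norm (\<Sum>k<n. R j k * x k))\<^sup>2"
    by (intro power_mono) auto
  also have "\<dots> \<le> (\<Sum>j<n. (norm (y j))\<^sup>2) * (\<Sum>j<n. (norm (\<Sum>k<n. R j k * x k))\<^sup>2)"
    by (rule Cauchy_Schwarz_ineq_sum)
  finally show ?thesis by (simp add: sq_norm_def)
qed

section \<open>The harmonic bound for the Frobenius norm\<close>

text \<open>Telescoping, from \<open>1 / t\<^sup>2 \<le> 2 / (t (t + 1))\<close> for \<open>t \<ge> 1\<close>.\<close>

lemma sum_inverse_squares_le:
  assumes "a > 0"
  shows "(\<Sum>k<m. 1 / (real (a + k))\<^sup>2) \<le> 2 / real a - 2 / real (a + m)"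
proof (induction m)
  case (Suc m)
  define t where "t = real (a + m)"
  have t: "t \<ge> 1" using assms by (simp add: t_def)
  have "1 / t\<^sup>2 \<le> 2 / t - 2 / (t + 1)"
  proof -
    have "1 / t\<^sup>2 = 2 / (2 * (t * t))" by (simp add: power2_eq_square)
    also have "\<dots> \<le> 2 / (t * (t + 1))"
      using t by (intro frac_le) (auto simp: algebra_simps add_pos_nonneg)
    also have "\<dots> = 2 / t - 2 / (t + 1)" using t by (simp add: field_simps)
    finally show ?thesis .
  qed
  then show ?case using Suc by (simp add: t_def add_ac)
qed simp

lemma harm_le_1_plus_ln:
  assumes "n > 0" shows "harm n \<le> 1 + ln (real n)"
  using euler_mascheroni_sequence_decreasing[of 1 n] assms by (simp add: harm_def)

text \<open>Each entry is dominated by \<open>1 / (n - j + k)\<^sup>2 + 1 / (n - k + j)\<^sup>2\<close>, one of the two terms being the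
  entry itself. Both terms have the same double sum, and summing over \<open>k\<close> first leaves a harmonic sum
  over \<open>n - j\<close>.\<close>

lemma sum_inverse_square_distance_le:
  assumes n: "n > 0"
  shows "(\<Sum>j<n. \<Sum>k<n. 1 / (real_of_int (int n - \<bar>int j - int k\<bar>))\<^sup>2) \<le> 4 * (1 + ln (real n))"
proof -
  define q where "q j k = 1 / (real (n - j + k))\<^sup>2" for j k
  have le: "1 / (real_of_int (int n - \<bar>int j - int k\<bar>))\<^sup>2 \<le> q j k + q k j" if "j < n" "k < n" for j k
  proof (cases "k \<le> j")
    case True
    then have "real_of_int (int n - \<bar>int j - int k\<bar>) = real (n - j + k)" using that by auto
    then have "1 / (real_of_int (int n - \<bar>int j - int k\<bar>))\<^sup>2 = q j k" by (simp only: q_def)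
    then show ?thesis by (simp add: q_def)
  next
    case False
    then have "real_of_int (int n - \<bar>int j - int k\<bar>) = real (n - k + j)" using that by auto
    then have "1 / (real_of_int (int n - \<bar>int j - int k\<bar>))\<^sup>2 = q k j" by (simp only: q_def)
    then show ?thesis by (simp add: q_def)
  qed
  have "(\<Sum>j<n. \<Sum>k<n. q j k) \<le> (\<Sum>j<n. 2 / real (n - j))"
  proof (intro sum_mono)
    fix j assume "j \<in> {..<n}"
    then have "(\<Sum>k<n. q j k) \<le> 2 / real (n - j) - 2 / real (n - j + n)"
      using sum_inverse_squares_le[of "n - j" n] by (simp add: q_def)
    then show "(\<Sum>k<n. q j k) \<le> 2 / real (n - j)"
      by (smt (verit) divide_nonneg_nonneg of_nat_0_le_iff)
  qed
  also have "\<dots> = (\<Sum>i<n. 2 / real (Suc i))"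
    by (rule sum.reindex_bij_witness[of _ "\<lambda>i. n - Suc i" "\<lambda>j. n - Suc j"]) (auto simp: Suc_diff_Suc)
  also have "\<dots> = 2 * harm n"
  proof -
    have "harm n = (\<Sum>i<n. inverse (real (Suc i)))"
      unfolding harm_def by (rule sum.reindex_bij_witness[of _ Suc "\<lambda>i. i - 1"]) auto
    then show ?thesis by (simp add: sum_distrib_left divide_inverse)
  qed
  also have "\<dots> \<le> 2 * (1 + ln (real n))" using harm_le_1_plus_ln[OF n] by simp
  finally have half: "(\<Sum>j<n. \<Sum>k<n. q j k) \<le> 2 * (1 + ln (real n))" .
  have "(\<Sum>j<n. \<Sum>k<n. 1 / (real_of_int (int n - \<bar>int j - int k\<bar>))\<^sup>2) \<le> (\<Sum>j<n. \<Sum>k<n. q j k + q k j)"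
    by (intro sum_mono le) auto
  also have "\<dots> = (\<Sum>j<n. \<Sum>k<n. q j k) + (\<Sum>j<n. \<Sum>k<n. q k j)"
    by (simp add: sum.distrib)
  also have "(\<Sum>j<n. \<Sum>k<n. q k j) = (\<Sum>j<n. \<Sum>k<n. q j k)" by (rule sum.swap)
  finally show ?thesis using half by linarith
qed

section \<open>Entries and inverses of the matrices\<close>

lemma integral_periodic:
  fixes h :: "real \<Rightarrow> complex"
  assumes int: "h integrable_on {0..2 * pi}" and per: "\<And>x. h (x + 2 * pi) = h x"
  shows "integral {-pi..pi} h = integral {0..2 * pi} h"
proof -
  have sub: "h integrable_on {0..pi}" "h integrable_on {pi..2 * pi}"
    by (rule integrable_on_subinterval[OF int], auto)+
  have shift: "integral {-pi..0} h = integral {pi..2 * pi} h"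
    using integral_shift_real_ivl[of pi "2 * pi" "2 * pi" h] per by simp
  have "h integrable_on {-pi..0}"
    using integrable_shift_real_ivl[OF sub(2), of "2 * pi"] per by simp
  then have "h integrable_on {-pi..pi}"
    using Henstock_Kurzweil_Integration.integrable_combine[of "-pi" 0 pi h] sub(1) by simp
  then have "integral {-pi..pi} h = integral {-pi..0} h + integral {0..pi} h"
    using Henstock_Kurzweil_Integration.integral_combine[of "-pi" 0 pi h] by simp
  moreover have "integral {0..2 * pi} h = integral {0..pi} h + integral {pi..2 * pi} h"
    using Henstock_Kurzweil_Integration.integral_combine[of 0 pi "2 * pi" h] int by simp
  ultimately show ?thesis using shift by simp
qed

lemma toeplitz_index:
  assumes "fourier_integrable f" "\<And>x. f (x + 2 * pi) = f x" "j < n" "k < n"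
  shows "toeplitz n f $$ (j, k) = fourier_coeff f (int j - int k)"
proof -
  have wave: "exp (- (\<i> * of_int (int j - int k) * complex_of_real x)) = wave (- (int j - int k)) x" for x
    by (simp add: wave_def algebra_simps)
  have "integral {-pi..pi} (\<lambda>x. f x * wave (- (int j - int k)) x) =
      integral {0..2 * pi} (\<lambda>x. f x * wave (- (int j - int k)) x)"
    using assms(1,2) by (intro integral_periodic) (auto simp: fourier_integrable_def wave_period simp del: minus_diff_eq)
  moreover have "toeplitz n f $$ (j, k) = 1 / (2 * complex_of_real pi) *
      integral {-pi..pi} (\<lambda>x. f x * exp (- (\<i> * of_int (int j - int k) * complex_of_real x)))"
    using assms(3,4) by (simp add: toeplitz_def)
  ultimately show ?thesis unfolding wave by (simp add: fourier_coeff_def)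
qed

lemma fourier_mat_carrier: "fourier_mat n \<in> carrier_mat n n"
  by (simp add: fourier_mat_def)

lemma fourier_mat_index:
  assumes "j < n" "k < n"
  shows "fourier_mat n $$ (j, k) = 1 / complex_of_real (sqrt (real n)) * wave (int k) (grid_point n j)"
  using assms by (simp add: fourier_mat_def wave_def grid_point_def field_simps flip: exp_of_nat_mult)

lemma circulant_carrier: "circulant n f \<in> carrier_mat n n"
  unfolding circulant_def
  by (intro mult_carrier_mat[of _ n n _ n] mat_diag_dim mat_adjoint_carrier fourier_mat_carrier)

lemma circulant_index:
  assumes jk: "j < n" "k < n"
  shows "circulant n f $$ (j, k) = sampled_coeff n f (int j - int k)"
proof -
  note F = fourier_mat_carrier[of n] and F' = mat_adjoint_carrier[OF fourier_mat_carrier[of n]]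
  have "circulant n f $$ (j, k) =
      (\<Sum>l<n. cnj (fourier_mat n $$ (l, j)) * f (grid_point n l) * fourier_mat n $$ (l, k))"
    unfolding circulant_def mat_diag_mult_right[OF F'] using F F' jk
    by (simp add: scalar_prod_def atLeast0LessThan mat_adjoint_index[OF F] grid_point_def)
  also have "\<dots> = (\<Sum>l<n. 1 / of_nat n * (f (grid_point n l) * wave (- (int j - int k)) (grid_point n l)))"
  proof (intro sum.cong refl)
    fix l assume "l \<in> {..<n}"
    then have l: "l < n" by simp
    have "complex_of_real (sqrt n) * complex_of_real (sqrt n) = of_nat n"
      by (simp flip: of_real_mult)
    moreover have "wave (- (int j - int k)) (grid_point n l) = wave (- int j) (grid_point n l) * wave (int k) (grid_point n l)"
      by (simp flip: wave_add)
    ultimately show "cnj (fourier_mat n $$ (l, j)) * f (grid_point n l) * fourier_mat n $$ (l, k) =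
        1 / of_nat n * (f (grid_point n l) * wave (- (int j - int k)) (grid_point n l))"
      using l jk by (simp add: fourier_mat_index cnj_wave mult_ac del: minus_diff_eq)
  qed
  finally show ?thesis by (simp add: sampled_coeff_def sum_distrib_left)
qed

lemma circulant_1: "circulant n (\<lambda>_. 1) = 1\<^sub>m n"
  using circulant_carrier[of n "\<lambda>_. 1"]
  by (intro eq_matI) (auto simp: circulant_index sampled_coeff_1)

text \<open>Circulant matrices are diagonalised simultaneously by the Fourier matrix, whose unitarity is the
  statement that the constant symbol 1 gives the identity matrix.\<close>

lemma circulant_mult: "circulant n f * circulant n g = circulant n (\<lambda>x. f x * g x)"
proof -
  note F = fourier_mat_carrier[of n] and F' = mat_adjoint_carrier[OF fourier_mat_carrier[of n]]
  define D where "D f = mat_diag n (\<lambda>k. f (2 * pi * real k / real n))" for f :: "real \<Rightarrow> complex"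
  have D: "D f \<in> carrier_mat n n" for f by (simp add: D_def)
  have C: "circulant n f = mat_adjoint (fourier_mat n) * (D f * fourier_mat n)" for f
    unfolding circulant_def D_def[symmetric] using F F' D[of f] by simp
  have "D (\<lambda>_. 1) = 1\<^sub>m n" by (simp add: D_def)
  then have "mat_adjoint (fourier_mat n) * fourier_mat n = 1\<^sub>m n"
    using circulant_1[of n] F by (simp add: C)
  then have FF: "fourier_mat n * mat_adjoint (fourier_mat n) = 1\<^sub>m n"
    by (rule mat_mult_left_right_inverse[OF F' F])
  have "circulant n f * circulant n g =
     mat_adjoint (fourier_mat n) * (D f * ((fourier_mat n * mat_adjoint (fourier_mat n)) * (D g * fourier_mat n)))"
    unfolding C using F F' D[of f] D[of g] by (simp add: assoc_mult_mat[of _ n n _ n _ n])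
  also have "\<dots> = mat_adjoint (fourier_mat n) * ((D f * D g) * fourier_mat n)"
    unfolding FF using F F' D[of f] D[of g] by (simp add: assoc_mult_mat[of _ n n _ n _ n])
  also have "D f * D g = D (\<lambda>x. f x * g x)" by (simp add: D_def)
  finally show ?thesis by (simp add: C)
qed

lemma mat_inverse_eqI:
  fixes A :: "'a :: field mat"
  assumes A: "A \<in> carrier_mat n n" and B: "B \<in> carrier_mat n n" and BA: "B * A = 1\<^sub>m n"
  shows "mat_inverse A = Some B"
proof (cases "mat_inverse A")
  case None
  have "A * B = 1\<^sub>m n" by (rule mat_mult_left_right_inverse[OF B A BA])
  then have "A \<in> Units (ring_mat TYPE('a) n ())"
    using A B BA by (auto simp: Units_def ring_mat_def)
  then show ?thesis using mat_inverse(1)[OF A None, of "()"] by blast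
next
  case (Some C)
  then have C: "A * C = 1\<^sub>m n" "C \<in> carrier_mat n n" using mat_inverse(2)[OF A] by auto
  have "B = B * (A * C)" using B C by simp
  also have "\<dots> = B * A * C" using A B C by simp
  finally show ?thesis using Some C unfolding BA by simp
qed

lemma mat_inverse_circulant:
  assumes "\<And>x. f x \<noteq> 0"
  shows "mat_inverse (circulant n f) = Some (circulant n (\<lambda>x. 1 / f x))"
  by (rule mat_inverse_eqI[OF circulant_carrier circulant_carrier])
     (simp add: circulant_mult assms circulant_1)

section \<open>Clustering of the preconditioned eigenvalues\<close>

text \<open>These are the entries of the Toeplitz matrix minus the circulant matrix.\<close>

definition aliasing_error :: "nat \<Rightarrow> (real \<Rightarrow> complex) \<Rightarrow> nat \<Rightarrow> nat \<Rightarrow> complex" where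
  "aliasing_error n g j k = fourier_coeff g (int j - int k) - sampled_coeff n g (int j - int k)"

lemma symbol_difference_form:
  assumes u: "fourier_integrable u" and f: "fourier_integrable f"
    and fu: "\<And>t. t \<in> {0..2 * pi} \<Longrightarrow> norm (f t - u t) \<le> \<delta>"
  shows "norm (sesq_form n (aliasing_error n f) y x - sesq_form n (aliasing_error n u) y x)
    \<le> \<delta> * (sq_norm n x + sq_norm n y)"
proof -
  define h where "h = (\<lambda>x. f x + (- 1) * u x)"
  have hi: "fourier_integrable h"
    unfolding h_def by (intro fourier_integrable_add fourier_integrable_cmult f u)
  have hb: "norm (h t) \<le> \<delta>" if "t \<in> {0..2 * pi}" for t using fu[OF that] by (simp add: h_def)
  have "fourier_coeff h d = fourier_coeff f d - fourier_coeff u d" for d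
    using fourier_coeff_add[OF f fourier_integrable_cmult[OF u], of "- 1" d]
    unfolding h_def fourier_coeff_cmult by simp
  moreover have "sampled_coeff n h d = sampled_coeff n f d - sampled_coeff n u d" for d
    by (simp add: h_def sampled_coeff_def left_diff_distrib right_diff_distrib sum_subtractf)
  ultimately have "aliasing_error n f j k = aliasing_error n h j k + aliasing_error n u j k" for j k
    by (simp add: aliasing_error_def)
  then have "sesq_form n (aliasing_error n f) y x - sesq_form n (aliasing_error n u) y x = sesq_form n (aliasing_error n h) y x"
    by (simp add: sesq_form_def ring_distribs sum.distrib)
  also have "\<dots> = sesq_form n (\<lambda>j k. fourier_coeff h (int j - int k)) y x - sesq_form n (\<lambda>j k. sampled_coeff n h (int j - int k)) y x"
    by (simp add: sesq_form_def aliasing_error_def left_diff_distrib right_diff_distrib sum_subtractf)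
  also have "norm \<dots> \<le> \<delta> / 2 * (sq_norm n x + sq_norm n y) + \<delta> / 2 * (sq_norm n x + sq_norm n y)"
    by (intro order_trans[OF norm_triangle_ineq4] add_mono toeplitz_form_bound circulant_form_bound hi hb)
  finally show ?thesis by simp
qed

text \<open>The vector \<open>y\<close> is the adjoint of the inverse circulant matrix applied to \<open>x\<close>, so this says that the
  inverse has operator norm at most \<open>1 / c\<close>. Evaluating the form of the inverse at \<open>x\<close> and \<open>c y\<close>
  gives \<open>c \<bar>y\<bar>\<^sup>2\<close>, while \<open>circulant_form_bound\<close> bounds it by \<open>(c\<^sup>2 \<bar>y\<bar>\<^sup>2 + 1) / (2 c)\<close>.\<close>

lemma circulant_inverse_adjoint_bound:
  assumes c: "c > 0" and f: "\<And>t. t \<in> {0..2 * pi} \<Longrightarrow> c \<le> norm (f t)"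
    and x: "sq_norm n x = 1"
  defines "y \<equiv> \<lambda>k. cnj (\<Sum>j<n. cnj (x j) * sampled_coeff n (\<lambda>t. 1 / f t) (int j - int k))"
  shows "sq_norm n (\<lambda>k. c * y k) \<le> 1"
proof -
  define b where "b = (\<lambda>j k. sampled_coeff n (\<lambda>t. 1 / f t) (int j - int k))"
  have scale: "sq_norm n (\<lambda>k. c * y k) = c\<^sup>2 * sq_norm n y"
    using c by (simp add: sq_norm_def norm_mult power_mult_distrib sum_distrib_left)
  have "sesq_form n b x (\<lambda>k. c * y k) = (\<Sum>k<n. \<Sum>j<n. cnj (x j) * b j k * (c * y k))"
    unfolding sesq_form_def by (rule sum.swap)
  also have "\<dots> = (\<Sum>k<n. c * (cnj (y k) * y k))"
    by (simp add: y_def b_def sum_distrib_left sum_distrib_right mult_ac)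
  also have "\<dots> = complex_of_real (c * sq_norm n y)"
    by (simp add: sq_norm_def sum_distrib_left complex_norm_square mult_ac del: of_real_power)
  finally have "norm (sesq_form n b x (\<lambda>k. c * y k)) = c * sq_norm n y"
    using c by (simp only: norm_of_real) (simp add: sq_norm_def sum_nonneg)
  moreover have "norm (sesq_form n b x (\<lambda>k. c * y k)) \<le> (1 / c) / 2 * (sq_norm n (\<lambda>k. c * y k) + sq_norm n x)"
    unfolding b_def
  proof (rule circulant_form_bound)
    fix t assume "t \<in> {0..2 * pi}"
    then show "norm (1 / f t) \<le> 1 / c"
      using f[of t] c by (simp add: norm_divide frac_le)
  qed
  ultimately have "c * sq_norm n y \<le> 1 / c / 2 * (c\<^sup>2 * sq_norm n y + 1)" by (simp add: x scale)
  then have "c\<^sup>2 * sq_norm n y \<le> 1"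
    using c by (simp add: field_simps power2_eq_square)
  then show ?thesis by (simp add: scale)
qed

text \<open>With \<open>B\<close> the inverse of the circulant matrix \<open>C\<close>, this is \<open>B T - 1 = B (T - C)\<close> with \<open>B\<close> moved to the
  left argument of the form as its adjoint.\<close>

lemma preconditioned_form:
  assumes per: "\<And>x. f (x + 2 * pi) = f x" and fi: "fourier_integrable f" and nz: "\<And>x. f x \<noteq> 0"
    and x: "sq_norm n x = 1"
  defines "y \<equiv> \<lambda>k. cnj (\<Sum>j<n. cnj (x j) * sampled_coeff n (\<lambda>t. 1 / f t) (int j - int k))"
  shows "sesq_form n (\<lambda>j k. preconditioned n f $$ (j, k)) x x - 1 = sesq_form n (aliasing_error n f) y x"
proof -
  define E where "E = aliasing_error n f"
  define b where "b = (\<lambda>j k. sampled_coeff n (\<lambda>t. 1 / f t) (int j - int k))"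
  note C = circulant_carrier[of n f] and B = circulant_carrier[of n "\<lambda>t. 1 / f t"]
  have T: "toeplitz n f \<in> carrier_mat n n" by (simp add: toeplitz_def)
  have M: "preconditioned n f = circulant n (\<lambda>t. 1 / f t) * toeplitz n f"
    by (simp add: preconditioned_def mat_inverse_circulant nz)
  have "circulant n (\<lambda>t. 1 / f t) * circulant n f = 1\<^sub>m n"
    by (simp add: circulant_mult nz circulant_1)
  have BE: "preconditioned n f $$ (j, k) - (if j = k then 1 else 0) = (\<Sum>l<n. b j l * E l k)"
    if jk: "j < n" "k < n" for j k
  proof -
    have "(\<Sum>l<n. b j l * fourier_coeff f (int l - int k)) = preconditioned n f $$ (j, k)"
      unfolding M using B T jk
      by (simp add: scalar_prod_def atLeast0LessThan b_def circulant_index toeplitz_index[OF fi per])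
    moreover have "(\<Sum>l<n. b j l * sampled_coeff n f (int l - int k)) =
        (circulant n (\<lambda>t. 1 / f t) * circulant n f) $$ (j, k)"
      using B C jk by (simp add: scalar_prod_def atLeast0LessThan b_def circulant_index)
    ultimately show ?thesis
      using jk by (simp add: E_def aliasing_error_def right_diff_distrib sum_subtractf circulant_mult nz circulant_1)
  qed
  have "sesq_form n (\<lambda>j k. preconditioned n f $$ (j, k)) x x - 1 =
      sesq_form n (\<lambda>j k. preconditioned n f $$ (j, k)) x x - sesq_form n (\<lambda>j k. if j = k then 1 else 0) x x"
    by (simp add: sesq_form_identity x)
  also have "\<dots> = (\<Sum>j<n. \<Sum>k<n. cnj (x j) * (preconditioned n f $$ (j, k) - (if j = k then 1 else 0)) * x k)"
    by (simp add: sesq_form_def left_diff_distrib right_diff_distrib sum_subtractf)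
  also have "\<dots> = (\<Sum>j<n. \<Sum>k<n. \<Sum>l<n. cnj (x j) * b j l * E l k * x k)"
    by (intro sum.cong refl) (simp add: BE sum_distrib_left sum_distrib_right mult_ac)
  also have "\<dots> = (\<Sum>j<n. \<Sum>l<n. \<Sum>k<n. cnj (x j) * b j l * E l k * x k)"
    by (intro sum.cong refl sum.swap)
  also have "\<dots> = (\<Sum>l<n. \<Sum>j<n. \<Sum>k<n. cnj (x j) * b j l * E l k * x k)"
    by (rule sum.swap)
  also have "\<dots> = (\<Sum>l<n. \<Sum>k<n. \<Sum>j<n. cnj (x j) * b j l * E l k * x k)"
    by (intro sum.cong refl sum.swap)
  also have "\<dots> = sesq_form n E y x"
    by (simp add: sesq_form_def y_def b_def sum_distrib_left sum_distrib_right mult_ac)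
  finally show ?thesis by (simp add: E_def)
qed

text \<open>Where the form of the preconditioned matrix is more than \<open>\<epsilon>\<close> away from 1, the form of the
  aliasing error of \<open>f\<close> at \<open>x\<close> and \<open>c y\<close> exceeds \<open>2 s\<close> with \<open>s = c \<epsilon> / 2\<close>. The step function is
  chosen so close to \<open>f\<close> that its own aliasing error still accounts for \<open>s\<close>, and that error has a
  Frobenius norm of logarithmic size.\<close>

lemma num_eigenvalues_preconditioned_le:
  fixes f :: "real \<Rightarrow> complex"
  assumes per: "\<And>x. f (x + 2 * pi) = f x"
    and disc: "\<And>x. x \<in> {0<..2 * pi} \<Longrightarrow> \<not> isCont f x \<Longrightarrow> \<exists>\<alpha>. has_jump f x \<alpha>"
    and nz: "without_zeros f" and \<epsilon>: "\<epsilon> > 0"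
  shows "\<exists>K. \<forall>n>0. real (num_eigenvalues_in (preconditioned n f) {z. dist z 1 > \<epsilon>}) \<le> K * (1 + ln (real n))"
proof -
  have right: "\<exists>r. (f \<longlongrightarrow> r) (at_right x)" if "0 \<le> x" "x < 2 * pi" for x
    using per disc that by (rule one_sided_limits(1))
  have left: "\<exists>l. (f \<longlongrightarrow> l) (at_left x)" if "0 < x" "x \<le> 2 * pi" for x
    using per disc that by (rule one_sided_limits(2))
  obtain c where c: "c > 0" "\<And>x. x \<in> {0..2 * pi} \<Longrightarrow> c \<le> norm (f x)"
    using bounded_away_from_zero[OF right left nz] by blast
  have f0: "f x \<noteq> 0" for x using nz by (simp add: without_zeros_def)
  have approx: "\<exists>u. well_sampled u \<and> (\<forall>x\<in>{0..2 * pi}. norm (f x - u x) \<le> \<delta>)" if "\<delta> > 0" for \<delta>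
    using well_sampled_step_approx[OF right left that] by metis
  have fi: "fourier_integrable f"
  proof (rule fourier_integrable_limit)
    fix \<delta> :: real assume "\<delta> > 0"
    from approx[OF this] show "\<exists>u. fourier_integrable u \<and> (\<forall>x\<in>{0..2 * pi}. norm (f x - u x) \<le> \<delta>)"
      unfolding well_sampled_def by blast
  qed
  define s where "s = c * \<epsilon> / 2"
  have c_\<epsilon>: "c * \<epsilon> = 2 * s" by (simp add: s_def)
  have s: "s > 0" using c \<epsilon> by (simp add: s_def)
  obtain u where u: "well_sampled u" "\<And>x. x \<in> {0..2 * pi} \<Longrightarrow> norm (f x - u x) \<le> s / 2"
    using approx[of "s / 2"] s by auto
  then obtain K where ui: "fourier_integrable u" and K: "\<And>n d. \<bar>d\<bar> < int n \<Longrightarrow>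
      norm (sampled_coeff n u d - fourier_coeff u d) \<le> K / real_of_int (int n - \<bar>d\<bar>)"
    unfolding well_sampled_def by blast
  have "real (num_eigenvalues_in (preconditioned n f) {z. dist z 1 > \<epsilon>}) \<le> 4 * K\<^sup>2 / s\<^sup>2 * (1 + ln (real n))"
    if n: "n > 0" for n
  proof -
    define E where "E = aliasing_error n"
    have M: "preconditioned n f \<in> carrier_mat n n"
      using circulant_carrier by (simp add: preconditioned_def mat_inverse_circulant f0 toeplitz_def mult_carrier_mat[of _ n n])
    have "real (num_eigenvalues_in (preconditioned n f) {z. dist z 1 > \<epsilon>}) * s\<^sup>2 \<le> (\<Sum>j<n. sq_norm n (E u j))"
    proof (rule num_eigenvalues_le[OF M])
      fix x assume x: "sq_norm n x = 1"
        and far: "sesq_form n (\<lambda>j k. preconditioned n f $$ (j, k)) x x \<in> {z. dist z 1 > \<epsilon>}"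
      define y where "y = (\<lambda>k. cnj (\<Sum>j<n. cnj (x j) * sampled_coeff n (\<lambda>t. 1 / f t) (int j - int k)))"
      have y: "sq_norm n (\<lambda>k. c * y k) \<le> 1"
        unfolding y_def by (rule circulant_inverse_adjoint_bound[OF c x])
      have scale: "sesq_form n (E f) (\<lambda>k. c * y k) x = c * sesq_form n (E f) y x"
        by (simp add: sesq_form_def sum_distrib_left mult_ac)
      have "\<epsilon> < norm (sesq_form n (E f) y x)"
        using far preconditioned_form[OF per fi f0 x] by (simp add: dist_norm E_def y_def)
      then have "c * \<epsilon> < norm (sesq_form n (E f) (\<lambda>k. c * y k) x)"
        using c unfolding scale by (simp add: norm_mult)
      then have "2 * s < norm (sesq_form n (E f) (\<lambda>k. c * y k) x)" by (simp only: c_\<epsilon>)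
      moreover have "norm (sesq_form n (E f) (\<lambda>k. c * y k) x - sesq_form n (E u) (\<lambda>k. c * y k) x) \<le> s"
      proof -
        have "norm (sesq_form n (E f) (\<lambda>k. c * y k) x - sesq_form n (E u) (\<lambda>k. c * y k) x) \<le>
            s / 2 * (sq_norm n x + sq_norm n (\<lambda>k. c * y k))"
          unfolding E_def by (rule symbol_difference_form[OF ui fi u(2)])
        also have "\<dots> \<le> s / 2 * (1 + 1)"
          using s y x by (intro mult_left_mono) auto
        finally show ?thesis by simp
      qed
      ultimately have "s \<le> norm (sesq_form n (E u) (\<lambda>k. c * y k) x)"
        using norm_triangle_ineq2[of "sesq_form n (E f) (\<lambda>k. c * y k) x" "sesq_form n (E u) (\<lambda>k. c * y k) x"]
        by linarith
      then have "s\<^sup>2 \<le> (norm (sesq_form n (E u) (\<lambda>k. c * y k) x))\<^sup>2" using s by (intro power_mono) auto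
      also have "\<dots> \<le> sq_norm n (\<lambda>k. c * y k) * sq_norm n (\<lambda>j. \<Sum>k<n. E u j k * x k)"
        by (rule sesq_form_Cauchy_Schwarz)
      also have "\<dots> \<le> 1 * sq_norm n (\<lambda>j. \<Sum>k<n. E u j k * x k)"
        by (intro mult_right_mono y) (simp add: sq_norm_def sum_nonneg)
      finally show "s\<^sup>2 \<le> sq_norm n (\<lambda>j. \<Sum>k<n. E u j k * x k)" by simp
    qed
    also have "\<dots> \<le> (\<Sum>j<n. \<Sum>k<n. K\<^sup>2 * (1 / (real_of_int (int n - \<bar>int j - int k\<bar>))\<^sup>2))"
      unfolding sq_norm_def
    proof (intro sum_mono)
      fix j k assume "j \<in> {..<n}" "k \<in> {..<n}"
      then have "norm (E u j k) \<le> K / real_of_int (int n - \<bar>int j - int k\<bar>)"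
        using K[of "int j - int k" n] by (simp add: E_def aliasing_error_def norm_minus_commute)
      then have "(norm (E u j k))\<^sup>2 \<le> (K / real_of_int (int n - \<bar>int j - int k\<bar>))\<^sup>2"
        by (intro power_mono) auto
      then show "(norm (E u j k))\<^sup>2 \<le> K\<^sup>2 * (1 / (real_of_int (int n - \<bar>int j - int k\<bar>))\<^sup>2)"
        by (simp add: power_divide)
    qed
    also have "\<dots> = K\<^sup>2 * (\<Sum>j<n. \<Sum>k<n. 1 / (real_of_int (int n - \<bar>int j - int k\<bar>))\<^sup>2)"
      by (simp only: sum_distrib_left)
    also have "\<dots> \<le> K\<^sup>2 * (4 * (1 + ln (real n)))"
      by (intro mult_left_mono sum_inverse_square_distance_le n) auto
    finally show ?thesis using s by (simp add: field_simps)
  qed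
  then show ?thesis by blast
qed

lemma num_eigenvalues_in_mono: "S \<subseteq> T \<Longrightarrow> num_eigenvalues_in A S \<le> num_eigenvalues_in A T"
  unfolding num_eigenvalues_in_def
  by (intro size_mset_mono mset_subset_eqI) auto

lemma complement_rectangle_subset: "- rectangle (1 - \<epsilon>) (1 + \<epsilon>) (- \<epsilon>) \<epsilon> \<subseteq> {z. dist z 1 > \<epsilon>}"
proof
  fix z assume "z \<in> - rectangle (1 - \<epsilon>) (1 + \<epsilon>) (- \<epsilon>) \<epsilon>"
  then have "\<bar>Re (z - 1)\<bar> > \<epsilon> \<or> \<bar>Im (z - 1)\<bar> > \<epsilon>" by (auto simp: rectangle_def)
  then show "z \<in> {z. dist z 1 > \<epsilon>}"
    using abs_Re_le_cmod[of "z - 1"] abs_Im_le_cmod[of "z - 1"] by (auto simp: dist_norm)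
qed

theorem mainTheorem12:
  fixes f :: "real \<Rightarrow> complex" and f1 f2 :: "real \<Rightarrow> real"
    and \<nu> :: nat and \<xi> :: "nat \<Rightarrow> real" and \<alpha> :: "nat \<Rightarrow> complex"
  assumes f_eq: "\<And>x. f x = complex_of_real (f1 x) + \<i> * complex_of_real (f2 x)"
    and f1_periodic: "\<And>x. f1 (x + 2 * pi) = f1 x"
    and f1_even: "\<And>x. f1 (- x) = f1 x"
    and f2_periodic: "\<And>x. f2 (x + 2 * pi) = f2 x"
    and f2_odd: "\<And>x. f2 (- x) = - f2 x"
    and \<xi>_distinct: "inj_on \<xi> {1..\<nu>}"
    and discontinuities: "{x \<in> {0<..2 * pi}. \<not> isCont f x} = \<xi> ` {1..\<nu>}"
    and jumps: "\<And>k. k \<in> {1..\<nu>} \<Longrightarrow> has_jump f (\<xi> k) (\<alpha> k)"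
    and no_zeros: "without_zeros f"
  shows "general_clustering (\<lambda>n. preconditioned n f) 1 \<and>
    (\<forall>\<epsilon>>0. (\<lambda>n. real (num_eigenvalues_in (preconditioned n f)
                     (- rectangle (1 - \<epsilon>) (1 + \<epsilon>) (- \<epsilon>) \<epsilon>)))
            \<in> O(\<lambda>n. ln (real n)))"
proof -
  have per: "f (x + 2 * pi) = f x" for x
    using f1_periodic f2_periodic by (simp add: f_eq)
  have disc: "\<exists>\<alpha>. has_jump f x \<alpha>" if "x \<in> {0<..2 * pi}" "\<not> isCont f x" for x
  proof -
    have "x \<in> \<xi> ` {1..\<nu>}" using that discontinuities by blast
    then obtain k where "k \<in> {1..\<nu>}" "x = \<xi> k" by blast
    then show ?thesis using jumps[of k] by blast
  qed
  have log: "(\<lambda>n. real (num_eigenvalues_in (preconditioned n f) {z. dist z 1 > \<epsilon>})) \<in> O(\<lambda>n. ln (real n))"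
    if \<epsilon>: "\<epsilon> > 0" for \<epsilon>
  proof -
    obtain K where K: "\<And>n. n > 0 \<Longrightarrow>
        real (num_eigenvalues_in (preconditioned n f) {z. dist z 1 > \<epsilon>}) \<le> K * (1 + ln (real n))"
      using num_eigenvalues_preconditioned_le[OF per disc no_zeros \<epsilon>] by blast
    have "(\<lambda>n. real (num_eigenvalues_in (preconditioned n f) {z. dist z 1 > \<epsilon>})) \<in> O(\<lambda>n. K * (1 + ln (real n)))"
    proof (rule landau_o.big_mono, rule eventually_mono[OF eventually_gt_at_top[of 0]])
      fix n :: nat assume "0 < n"
      from K[OF this] show "norm (real (num_eigenvalues_in (preconditioned n f) {z. dist z 1 > \<epsilon>}))
          \<le> norm (K * (1 + ln (real n)))" by simp
    qed
    also have "(\<lambda>n. K * (1 + ln (real n))) \<in> O(\<lambda>n. ln (real n))" by real_asymp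
    finally show ?thesis .
  qed
  have "general_clustering (\<lambda>n. preconditioned n f) 1"
    unfolding general_clustering_def
  proof (intro allI impI)
    fix \<epsilon> :: real assume "\<epsilon> > 0"
    have "(\<lambda>n. ln (real n)) \<in> o(\<lambda>n. real n)" by real_asymp
    with log[OF \<open>\<epsilon> > 0\<close>]
    show "(\<lambda>n. real (num_eigenvalues_in (preconditioned n f) {z. dist z 1 > \<epsilon>})) \<in> o(\<lambda>n. real n)"
      by (rule landau_o.big_small_trans)
  qed
  moreover have "(\<lambda>n. real (num_eigenvalues_in (preconditioned n f)
        (- rectangle (1 - \<epsilon>) (1 + \<epsilon>) (- \<epsilon>) \<epsilon>))) \<in> O(\<lambda>n. ln (real n))" if \<epsilon>: "\<epsilon> > 0" for \<epsilon>
  proof -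
    have "(\<lambda>n. real (num_eigenvalues_in (preconditioned n f) (- rectangle (1 - \<epsilon>) (1 + \<epsilon>) (- \<epsilon>) \<epsilon>)))
        \<in> O(\<lambda>n. real (num_eigenvalues_in (preconditioned n f) {z. dist z 1 > \<epsilon>}))"
      using num_eigenvalues_in_mono[OF complement_rectangle_subset] by (intro landau_o.big_mono) simp
    also note log[OF \<epsilon>]
    finally show ?thesis .
  qed
  ultimately show ?thesis by blast
qed

end
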